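(* Let $G$ be a Hausdorff topological group. The following are equivalent. (1) $G$ is amenable. (2) For every $U \in \mathcal{U}_{e}(G)$, there exists $\alpha \in \mathcal{N}_{G}(U)$ such that the action of $\Gamma(\alpha)$ on the set $G$ is amenable. (3) For every $U \in \mathcal{U}_{e}(G)$, the action of $\Gamma_{U}(G)$ on the set $G \times \mathcal{N}_{G}(U)$ is amenable.
   Context: $\mathcal{U}_{e}(G)$ denotes the neighborhood filter of the neutral element $e$ of $G$. Amenable topological group: for $g \in G$ let $\lambda_{g}(x) = gx$. $\mathrm{RUC}_{b}(G)$ is the space of bounded real-valued functions on $G$ that are uniformly continuous with respect to the right uniformity (whose entourages are the sets containing $\{(x,y) \mid xy^{-1} \in U\}$ for some $U \in \mathcal{U}_{e}(G)$). $G$ is amenable if there is a positive linear map $\mu \colon \mathrm{RUC}_{b}(G) \to \mathbb{R}$ with $\mu(\mathbf{1}) = 1$ and $\mu(f \circ \lambda_{g}) = \mu(f)$ for all $f \in \mathrm{RUC}_{b}(G)$, $g \in G$. Amenable action: an action of a (discrete) group $\Gamma$ on a non-empty set $X$ is amenable if there is a positive linear map $\mu \colon \ell^{\infty}(X) \to \mathbb{R}$ with $\mu(\mathbf{1}) = 1$ and $\mu(f \circ \gamma) = \mu(f)$ for all $f \in \ell^{\infty}(X)$ and $\gamma \in \Gamma$, where $\ell^\infty(X)$ is the space of bounded real-valued functions on $X$. For a set $X$, $\mathrm{Sym}(X)$ is the group of all bijections of $X$. For $U \in \mathcal{U}_{e}(G)$, $\mathcal{N}_{G}(U)$ is the set of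 all maps $\alpha \colon G \to \mathrm{Sym}(G)$ (not necessarily homomorphisms) such that $\alpha(g)(h) \in Ugh$ for all $g,h \in G$. For sets $I,X$ and a map $\alpha \colon I \to \mathrm{Sym}(X)$, $\Gamma(\alpha)$ is the subgroup of $\mathrm{Sym}(X)$ generated by $\{\alpha(i) \mid i \in I\}$. For a family of maps $\alpha_{j} \colon I \to \mathrm{Sym}(X)$ $(j \in J)$, the map $\bigoplus_{j \in J} \alpha_{j} \colon I \to \mathrm{Sym}(X \times J)$ is defined by $(\bigoplus_{j \in J} \alpha_{j})(i)(x,j) = (\alpha_{j}(i)(x),j)$. Finally, $\Gamma_{U}(G) = \Gamma\big(\bigoplus_{\alpha \in \mathcal{N}_{G}(U)} \alpha\big) \leq \mathrm{Sym}(G \times \mathcal{N}_{G}(U))$. *)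

theory Defs
  imports "HOL-Analysis.Analysis" "HOL-Algebra.Group_Action" "HOL-Algebra.Generated_Groups"
begin

text \<open>
  A Hausdorff topological group is a type of class \<open>{topological_group_add, t2_space}\<close>. This class
  does not assume commutativity; the group operation is merely written additively, so that
  \<open>0\<close> is the neutral element, \<open>g + x\<close> the product \<open>g x\<close> and \<open>x - y\<close> the product of \<open>x\<close> with the
  inverse of \<open>y\<close> (in this order). \<open>Sym(X)\<close> is \<open>BijGroup X\<close>, whose elements are the bijections of \<open>X\<close>
  that are extensional, i.e. take a fixed dummy value outside of \<open>X\<close>.
\<close>

section \<open>Means\<close>

text \<open>
  \<open>is_mean X F \<mu>\<close>: \<open>\<mu>\<close> is a positive normalized linear functional on a space \<open>F\<close> of real functions on
  \<open>X\<close>. Functions on \<open>X\<close> are represented by functions on the whole type. Since positivity only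
  refers to values on \<open>X\<close>, two members of \<open>F\<close> that agree on \<open>X\<close> have the same mean (see the lemma
  below), so \<open>\<mu>\<close> really is a functional on functions with domain \<open>X\<close>.
\<close>

definition is_mean :: "'x set \<Rightarrow> ('x \<Rightarrow> real) set \<Rightarrow> (('x \<Rightarrow> real) \<Rightarrow> real) \<Rightarrow> bool" where
  "is_mean X F \<mu> \<longleftrightarrow>
     (\<forall>f\<in>F. \<forall>g\<in>F. \<mu> (\<lambda>x. f x + g x) = \<mu> f + \<mu> g) \<and>
     (\<forall>c. \<forall>f\<in>F. \<mu> (\<lambda>x. c * f x) = c * \<mu> f) \<and>
     (\<forall>f\<in>F. (\<forall>x\<in>X. 0 \<le> f x) \<longrightarrow> 0 \<le> \<mu> f) \<and>
     \<mu> (\<lambda>x. 1) = 1"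

definition ell_infty :: "'x set \<Rightarrow> ('x \<Rightarrow> real) set" where
  "ell_infty X = {f. bounded (f ` X)}"

lemma is_mean_ell_infty_cong:
  assumes "is_mean X (ell_infty X) \<mu>" "f \<in> ell_infty X" "g \<in> ell_infty X" "\<And>x. x \<in> X \<Longrightarrow> f x = g x"
  shows "\<mu> f = \<mu> g"
proof -
  have add: "\<And>f g. f \<in> ell_infty X \<Longrightarrow> g \<in> ell_infty X \<Longrightarrow> \<mu> (\<lambda>x. f x + g x) = \<mu> f + \<mu> g"
    and scale: "\<And>c f. f \<in> ell_infty X \<Longrightarrow> \<mu> (\<lambda>x. c * f x) = c * \<mu> f"
    and pos: "\<And>f. f \<in> ell_infty X \<Longrightarrow> (\<And>x. x \<in> X \<Longrightarrow> 0 \<le> f x) \<Longrightarrow> 0 \<le> \<mu> f"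
    using assms(1) by (simp_all add: is_mean_def)
  have le: "\<mu> h \<le> \<mu> k"
    if hk: "h \<in> ell_infty X" "k \<in> ell_infty X" "\<And>x. x \<in> X \<Longrightarrow> h x = k x" for h k
  proof -
    let ?m = "\<lambda>x. (-1) * h x"
    have m: "?m \<in> ell_infty X"
      using hk(1) by (auto simp: ell_infty_def bounded_iff)
    have "(\<lambda>x. k x + ?m x) ` X \<subseteq> {0}"
      using hk(3) by auto
    then have s: "(\<lambda>x. k x + ?m x) \<in> ell_infty X"
      unfolding ell_infty_def using bounded_subset[of "{0::real}"] by blast
    have "0 \<le> \<mu> (\<lambda>x. k x + ?m x)"
      by (rule pos[OF s]) (simp add: hk(3))
    also have "\<dots> = \<mu> k + \<mu> ?m"
      by (rule add[OF hk(2) m])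
    also have "\<mu> ?m = (-1) * \<mu> h"
      by (rule scale[OF hk(1)])
    finally show ?thesis by simp
  qed
  show ?thesis
    using le[OF assms(2,3)] le[OF assms(3,2)] assms(4) by (simp add: order_antisym)
qed

section \<open>Amenable topological groups\<close>

definition nbhds_neutral :: "'a::topological_group_add set set" where
  "nbhds_neutral = {U. \<forall>\<^sub>F x in nhds 0. x \<in> U}"

definition right_uniformity :: "('a::topological_group_add \<times> 'a) filter" where
  "right_uniformity = filtercomap (\<lambda>(x, y). x - y) (nhds 0)"

lemma eventually_right_uniformity:
  "(\<forall>\<^sub>F p in right_uniformity. p \<in> E) \<longleftrightarrow> (\<exists>U\<in>nbhds_neutral. {(x, y). x - y \<in> U} \<subseteq> E)"
proof
  assume "\<forall>\<^sub>F p in right_uniformity. p \<in> E"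
  then obtain Q where "eventually Q (nhds 0)" "\<And>p. Q (case p of (x, y) \<Rightarrow> x - y) \<Longrightarrow> p \<in> E"
    unfolding right_uniformity_def eventually_filtercomap by blast
  then show "\<exists>U\<in>nbhds_neutral. {(x, y). x - y \<in> U} \<subseteq> E"
    by (intro bexI[of _ "Collect Q"]) (auto simp: nbhds_neutral_def)
next
  assume "\<exists>U\<in>nbhds_neutral. {(x, y). x - y \<in> U} \<subseteq> E"
  then obtain U where "\<forall>\<^sub>F x in nhds 0. x \<in> U" "{(x, y). x - y \<in> U} \<subseteq> E"
    by (auto simp: nbhds_neutral_def)
  then show "\<forall>\<^sub>F p in right_uniformity. p \<in> E"
    unfolding right_uniformity_def eventually_filtercomap
    by (intro exI[of _ "\<lambda>x. x \<in> U"]) auto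
qed

definition RUC_b :: "('a::topological_group_add \<Rightarrow> real) set" where
  "RUC_b = {f. bounded (range f) \<and> (LIM (x, y) right_uniformity. (f x, f y) :> uniformity)}"

definition amenable_topological_group :: "'a::topological_group_add itself \<Rightarrow> bool" where
  "amenable_topological_group _ \<longleftrightarrow>
     (\<exists>\<mu>. is_mean UNIV (RUC_b :: ('a \<Rightarrow> real) set) \<mu> \<and>
          (\<forall>f\<in>RUC_b. \<forall>g. \<mu> (f \<circ> (\<lambda>x. g + x)) = \<mu> f))"

section \<open>Amenable actions\<close>

definition amenable_action :: "('g, 'm) monoid_scheme \<Rightarrow> 'x set \<Rightarrow> ('g \<Rightarrow> 'x \<Rightarrow> 'x) \<Rightarrow> bool" where
  "amenable_action \<Gamma> X \<phi> \<longleftrightarrow> group_action \<Gamma> X \<phi> \<and> X \<noteq> {} \<and>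
     (\<exists>\<mu>. is_mean X (ell_infty X) \<mu> \<and>
          (\<forall>f\<in>ell_infty X. \<forall>\<gamma>\<in>carrier \<Gamma>. \<mu> (f \<circ> \<phi> \<gamma>) = \<mu> f))"

section \<open>Perturbed translations and the groups they generate\<close>

definition perturbed_translations :: "'a::topological_group_add set \<Rightarrow> ('a \<Rightarrow> 'a \<Rightarrow> 'a) set" where
  "perturbed_translations U =
     {\<alpha>. (\<forall>g. \<alpha> g \<in> carrier (BijGroup UNIV)) \<and> (\<forall>g h. \<alpha> g h \<in> (\<lambda>u. u + g + h) ` U)}"

definition generated_perm_group :: "'x set \<Rightarrow> 'i set \<Rightarrow> ('i \<Rightarrow> 'x \<Rightarrow> 'x) \<Rightarrow> ('x \<Rightarrow> 'x) monoid" where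
  "generated_perm_group X I \<alpha> = (BijGroup X)\<lparr>carrier := generate (BijGroup X) (\<alpha> ` I)\<rparr>"

definition perm_direct_sum ::
    "'x set \<Rightarrow> 'j set \<Rightarrow> ('j \<Rightarrow> 'i \<Rightarrow> 'x \<Rightarrow> 'x) \<Rightarrow> 'i \<Rightarrow> 'x \<times> 'j \<Rightarrow> 'x \<times> 'j" where
  "perm_direct_sum X J \<alpha> i = restrict (\<lambda>(x, j). (\<alpha> j i x, j)) (X \<times> J)"

text \<open>The group \<open>\<Gamma>\<^sub>U(G)\<close>; the family being summed is \<open>perturbed_translations U\<close> indexed by itself.\<close>

definition Gamma_U ::
    "'a::topological_group_add set \<Rightarrow>
     ('a \<times> ('a \<Rightarrow> 'a \<Rightarrow> 'a) \<Rightarrow> 'a \<times> ('a \<Rightarrow> 'a \<Rightarrow> 'a)) monoid" where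
  "Gamma_U U = generated_perm_group (UNIV \<times> perturbed_translations U) UNIV
     (perm_direct_sum UNIV (perturbed_translations U) (\<lambda>\<alpha>. \<alpha>))"

lemma perm_direct_sum_in_Sym:
  assumes "\<And>j. j \<in> J \<Longrightarrow> \<alpha> j i \<in> carrier (BijGroup X)"
  shows "perm_direct_sum X J \<alpha> i \<in> carrier (BijGroup (X \<times> J))"
proof -
  have b: "bij_betw (\<alpha> j i) X X" if "j \<in> J" for j
    using assms[OF that] by (simp add: BijGroup_def Bij_def)
  have "bij_betw (\<lambda>(x, j). (\<alpha> j i x, j)) (X \<times> J) (X \<times> J)"
    unfolding bij_betw_def
  proof
    show "inj_on (\<lambda>(x, j). (\<alpha> j i x, j)) (X \<times> J)"
      using b by (auto simp: inj_on_def bij_betw_def)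
    show "(\<lambda>(x, j). (\<alpha> j i x, j)) ` (X \<times> J) = X \<times> J"
    proof (intro equalityI subsetI)
      fix p assume "p \<in> (\<lambda>(x, j). (\<alpha> j i x, j)) ` (X \<times> J)"
      then show "p \<in> X \<times> J" using b by (auto simp: bij_betw_def)
    next
      fix p assume "p \<in> X \<times> J"
      then obtain y j where p: "p = (y, j)" "y \<in> X" "j \<in> J" by auto
      have "y \<in> \<alpha> j i ` X"
        using p b[of j] by (simp add: bij_betw_def)
      then obtain x where "x \<in> X" "\<alpha> j i x = y" by auto
      then show "p \<in> (\<lambda>(x, j). (\<alpha> j i x, j)) ` (X \<times> J)"
        using p by (auto intro!: rev_image_eqI[of "(x, j)"])
    qed
  qed
  then show ?thesis
    by (simp add: perm_direct_sum_def BijGroup_def Bij_def cong: bij_betw_cong)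
qed

lemma group_action_generated_perm_group:
  assumes "\<And>i. i \<in> I \<Longrightarrow> \<alpha> i \<in> carrier (BijGroup X)"
  shows "group_action (generated_perm_group X I \<alpha>) X (\<lambda>\<gamma>. \<gamma>)"
proof -
  interpret S: group "BijGroup X" by (rule group_BijGroup)
  have sub: "subgroup (generate (BijGroup X) (\<alpha> ` I)) (BijGroup X)"
    using assms by (intro S.generate_is_subgroup) auto
  then have "group (generated_perm_group X I \<alpha>)"
    unfolding generated_perm_group_def by (rule S.subgroup_imp_group)
  moreover have "(\<lambda>\<gamma>. \<gamma>) \<in> hom (generated_perm_group X I \<alpha>) (BijGroup X)"
    using subgroup.subset[OF sub] by (auto simp: hom_def generated_perm_group_def)
  ultimately show ?thesis
    by (simp add: group_action_def group_hom_def group_hom_axioms_def S.is_group)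
qed

end

theory Submission
  imports Defs "HOL-Algebra.Free_Abelian_Groups"
begin

text \<open>
  Perturbed translations in \<open>\<N>(U)\<close> are uniformly \<open>U\<close>-close to the actual ones, so a mean invariant under
  them is almost invariant on right uniformly continuous functions; a limit along \<open>U \<rightarrow> 0\<close> gives
  amenability from (2) or (3). A mean on \<open>G\<close> witnessing (2) for \<open>\<alpha>\<close> yields one for (3) on the slice
  \<open>G \<times> {\<alpha>}\<close>.

  For (1) to (2) in a non-discrete group, a minimax argument against the family of functions that are
  1-Lipschitz for a continuous right-invariant pseudometric turns the invariant mean into finitely
  supported weights that almost satisfy Hall's condition for \<open>s \<mapsto> V + g + s\<close>. Neighbourhoods of \<open>0\<close>
  are infinite, so the weights can be rounded to a finite set \<open>F\<close> whose points are generic enough that \<open>F\<close>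
  and \<open>g + F\<close> are disjoint for \<open>g \<noteq> 0\<close>. Hall's theorem then matches most of \<open>g + F\<close> with points of \<open>F\<close>,
  and by disjointness the matching extends to a permutation of \<open>G\<close> by swapping. Right translation
  preserves all of this, so the sets belonging to the various finite \<open>E \<subseteq> G\<close> can be made disjoint; then
  one \<open>\<alpha>\<close> serves all of them, and the averages over these sets converge to an invariant mean.
\<close>

section \<open>Limits of means\<close>

text \<open>By Tychonoff the box of all admissible values is compact, so the image filter of
  \<open>\<Phi>\<close> under \<open>m\<close> has a cluster point \<open>L\<close>; meeting
  \<open>\<Phi>\<close> with the preimages of neighbourhoods of \<open>L\<close> gives convergence.
  The filter \<open>\<Psi>\<close> plays the part of a convergent subnet.\<close>

lemma bounded_family_convergent_refinement:
  fixes m :: "'i \<Rightarrow> 'k \<Rightarrow> real"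
  assumes "\<And>i k. \<bar>m i k\<bar> \<le> B k" and "\<Phi> \<noteq> bot"
  obtains \<Psi> L where "\<Psi> \<le> \<Phi>" "\<Psi> \<noteq> bot" "\<And>k. ((\<lambda>i. m i k) \<longlongrightarrow> L k) \<Psi>"
proof -
  define K where "K = PiE UNIV (\<lambda>k. {- B k..B k})"
  have "compactin (product_topology (\<lambda>k::'k. euclideanreal) UNIV) K"
    unfolding K_def compactin_PiE by auto
  then have K: "compact K"
    by (simp add: euclidean_product_topology)
  have mK: "m i \<in> K" for i
    using assms(1)[of i] by (auto simp: K_def abs_le_iff minus_le_iff)
  have "filtermap m \<Phi> \<noteq> bot"
    using assms(2) by (simp add: filtermap_bot_iff)
  moreover have "eventually (\<lambda>x. x \<in> K) (filtermap m \<Phi>)"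
    by (simp add: eventually_filtermap mK)
  ultimately obtain L where L: "inf (nhds L) (filtermap m \<Phi>) \<noteq> bot"
    using K unfolding compact_filter le_principal by blast
  define \<Psi> where "\<Psi> = inf (filtercomap m (nhds L)) \<Phi>"
  have "\<Psi> \<noteq> bot"
  proof
    assume "\<Psi> = bot"
    then obtain P Q where PQ: "eventually P (filtercomap m (nhds L))" "eventually Q \<Phi>"
        "\<And>x. P x \<and> Q x \<Longrightarrow> False"
      unfolding \<Psi>_def trivial_limit_def eventually_inf by blast
    then obtain P' where P': "eventually P' (nhds L)" "\<And>x. P' (m x) \<Longrightarrow> P x"
      unfolding eventually_filtercomap by blast
    \<comment> \<open>Pushing \<open>Q\<close> forward along \<open>m\<close> would separate
      \<open>L\<close> from the image filter, against the choice of \<open>L\<close> as a cluster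
      point.\<close>
    have "eventually (\<lambda>y. \<not> P' y) (filtermap m \<Phi>)"
      unfolding eventually_filtermap using PQ(2) by eventually_elim (use PQ(3) P'(2) in blast)
    with P'(1) have "eventually (\<lambda>_. False) (inf (nhds L) (filtermap m \<Phi>))"
      unfolding eventually_inf by blast
    with L show False by (simp add: trivial_limit_def)
  qed
  moreover have "((\<lambda>i. m i k) \<longlongrightarrow> L k) \<Psi>" for k
  proof -
    have "((\<lambda>x. x k) \<longlongrightarrow> L k) (nhds L)"
    proof (rule topological_tendstoI)
      fix S :: "real set" assume "open S" "L k \<in> S"
      moreover have "open ((\<lambda>x::'k \<Rightarrow> real. x k) -` S)"
        using \<open>open S\<close> by (intro open_vimage) simp_all
      ultimately show "eventually (\<lambda>x. x k \<in> S) (nhds L)"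
        unfolding eventually_nhds by (intro exI[of _ "(\<lambda>x. x k) -` S"]) auto
    qed
    moreover have "filterlim m (nhds L) \<Psi>"
      unfolding \<Psi>_def by (simp add: filterlim_iff_le_filtercomap)
    ultimately show ?thesis by (rule filterlim_compose)
  qed
  ultimately show thesis using that[of \<Psi> L] by (simp add: \<Psi>_def)
qed

lemma is_meanD:
  assumes "is_mean X F \<mu>"
  shows is_mean_add: "f \<in> F \<Longrightarrow> g \<in> F \<Longrightarrow> \<mu> (\<lambda>x. f x + g x) = \<mu> f + \<mu> g"
    and is_mean_scale: "f \<in> F \<Longrightarrow> \<mu> (\<lambda>x. c * f x) = c * \<mu> f"
    and is_mean_nonneg: "f \<in> F \<Longrightarrow> (\<And>x. x \<in> X \<Longrightarrow> 0 \<le> f x) \<Longrightarrow> 0 \<le> \<mu> f"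
    and is_mean_one: "\<mu> (\<lambda>x. 1) = 1"
  using assms unfolding is_mean_def by simp_all

text \<open>Positivity applied to \<open>c - f\<close>. Closure of \<open>F\<close> under sums and
  multiples is assumed instead of fixing a space because both \<open>ell_infty\<close> and
  \<open>RUC_b\<close> occur.\<close>

lemma is_mean_bound:
  assumes m: "is_mean X F \<mu>" and f: "f \<in> F" and one: "(\<lambda>_. 1) \<in> F" 
    and add: "\<And>f g. f \<in> F \<Longrightarrow> g \<in> F \<Longrightarrow> (\<lambda>x. f x + g x) \<in> F"
    and scale: "\<And>c f. f \<in> F \<Longrightarrow> (\<lambda>x. c * f x) \<in> F"
    and ub: "\<And>x. x \<in> X \<Longrightarrow> f x \<le> c"
  shows "\<mu> f \<le> c"
proof -
  have c: "(\<lambda>x. c * 1) \<in> F" and n: "(\<lambda>x. (-1) * f x) \<in> F"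
    using scale[OF one, of c] scale[OF f, of "-1"] by simp_all
  have "0 \<le> \<mu> (\<lambda>x. c * 1 + (-1) * f x)"
    by (rule is_mean_nonneg[OF m add[OF c n]]) (use ub in simp)
  also have "\<dots> = \<mu> (\<lambda>x. c * 1) + \<mu> (\<lambda>x. (-1) * f x)"
    by (rule is_mean_add[OF m c n])
  also have "\<mu> (\<lambda>x. c * 1) = c * \<mu> (\<lambda>x. 1)"
    by (rule is_mean_scale[OF m one])
  also have "\<mu> (\<lambda>x. (-1) * f x) = (-1) * \<mu> f"
    by (rule is_mean_scale[OF m f])
  finally show ?thesis by (simp add: is_mean_one[OF m])
qed

text \<open>All values at one \<open>f\<close> lie in a bounded interval, so some refinement makes
  every coordinate converge, and the conditions on a mean survive pointwise limits. The second
  conclusion turns asymptotic invariance along \<open>\<Phi>\<close> into exact invariance of the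
  limit.\<close>

lemma is_mean_limit:
  assumes mean: "\<And>i. is_mean X F (m i)"
    and one: "(\<lambda>_. 1) \<in> F"
    and add: "\<And>f g. f \<in> F \<Longrightarrow> g \<in> F \<Longrightarrow> (\<lambda>x. f x + g x) \<in> F"
    and scale: "\<And>c f. f \<in> F \<Longrightarrow> (\<lambda>x. c * f x) \<in> F"
    and bdd: "\<And>f. f \<in> F \<Longrightarrow> bounded (f ` X)"
    and \<Phi>: "\<Phi> \<noteq> bot"
  obtains M where "is_mean X F M"
    "\<And>f g. f \<in> F \<Longrightarrow> g \<in> F \<Longrightarrow> ((\<lambda>i. m i f - m i g) \<longlongrightarrow> 0) \<Phi> \<Longrightarrow> M f = M g"
proof -
  have "\<exists>B. \<forall>x\<in>X. \<bar>f x\<bar> \<le> B" if "f \<in> F" for f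
    using bdd[OF that] by (auto simp: bounded_iff)
  then obtain B where B: "\<And>f x. f \<in> F \<Longrightarrow> x \<in> X \<Longrightarrow> \<bar>f x\<bar> \<le> B f" by metis
  \<comment> \<open>Cutting off by \<open>0\<close> outside \<open>F\<close> gives a bound at every
    function, as the compactness lemma requires.\<close>
  define m' where "m' i f = (if f \<in> F then m i f else 0)" for i f
  define B' where "B' f = (if f \<in> F then B f else 0)" for f
  have "\<bar>m' i f\<bar> \<le> B' f" for i f
  proof (cases "f \<in> F")
    case True
    have "m i f \<le> B f"
      by (rule is_mean_bound[OF mean True one add scale]) (use B[OF True] in \<open>auto simp: abs_le_iff\<close>)
    moreover have "m i (\<lambda>x. (-1) * f x) \<le> B f"
      by (rule is_mean_bound[OF mean scale[OF True] one add scale])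
         (use B[OF True] in \<open>auto simp: abs_le_iff\<close>)
    moreover have "m i (\<lambda>x. (-1) * f x) = (-1) * m i f"
      by (rule is_mean_scale[OF mean True])
    ultimately show ?thesis using True by (simp add: m'_def B'_def)
  qed (simp add: m'_def B'_def)
  then obtain \<Psi> L where \<Psi>: "\<Psi> \<le> \<Phi>" "\<Psi> \<noteq> bot" and "\<And>f. ((\<lambda>i. m' i f) \<longlongrightarrow> L f) \<Psi>"
    using bounded_family_convergent_refinement \<Phi> by metis
  then have L': "\<And>f. ((\<lambda>i. m' i f) \<longlongrightarrow> L f) \<Psi>" by blast
  have L: "((\<lambda>i. m i f) \<longlongrightarrow> L f) \<Psi>" if "f \<in> F" for f
    using L'[of f] that by (simp add: m'_def)
  note uniq = tendsto_unique[OF \<Psi>(2)]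
  have "is_mean X F L"
    unfolding is_mean_def
  proof (intro conjI ballI allI impI)
    fix f g assume fg: "f \<in> F" "g \<in> F"
    have "m i (\<lambda>x. f x + g x) = m i f + m i g" for i
      by (rule is_mean_add[OF mean fg])
    then show "L (\<lambda>x. f x + g x) = L f + L g"
      using uniq[OF L[OF add[OF fg]]] tendsto_add[OF L[OF fg(1)] L[OF fg(2)]] by simp
  next
    fix c f assume f: "f \<in> F"
    have "m i (\<lambda>x. c * f x) = c * m i f" for i
      by (rule is_mean_scale[OF mean f])
    then show "L (\<lambda>x. c * f x) = c * L f"
      using uniq[OF L[OF scale[OF f]]] tendsto_mult_left[OF L[OF f]] by simp
  next
    fix f assume f: "f \<in> F" "\<forall>x\<in>X. 0 \<le> f x"
    have "0 \<le> m i f" for i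
      by (rule is_mean_nonneg[OF mean]) (use f in auto)
    then show "0 \<le> L f"
      using tendsto_lowerbound[OF L[OF f(1)] _ \<Psi>(2)] by simp
  next
    have "m i (\<lambda>_. 1) = 1" for i by (rule is_mean_one[OF mean])
    then show "L (\<lambda>_. 1) = 1" using uniq[OF L[OF one]] tendsto_const[of 1 \<Psi>] by simp
  qed
  moreover have "L f = L g"
    if "f \<in> F" "g \<in> F" and lim: "((\<lambda>i. m i f - m i g) \<longlongrightarrow> 0) \<Phi>" for f g
    using uniq[OF tendsto_diff[OF L[OF that(1)] L[OF that(2)]] tendsto_mono[OF \<Psi>(1) lim]] by simp
  ultimately show thesis using that by blast
qed

section \<open>Invariant means for groups given by generators\<close>

lemma ell_infty_const: "(\<lambda>_. c) \<in> ell_infty X"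
  by (auto simp: ell_infty_def bounded_iff)

lemma ell_infty_add: "f \<in> ell_infty X \<Longrightarrow> g \<in> ell_infty X \<Longrightarrow> (\<lambda>x. f x + g x) \<in> ell_infty X"
  unfolding ell_infty_def by (auto simp: bounded_plus_comp)

lemma ell_infty_scale: "f \<in> ell_infty X \<Longrightarrow> (\<lambda>x. c * f x) \<in> ell_infty X"
  unfolding ell_infty_def bounded_iff
  by (auto simp: abs_mult) (metis abs_ge_zero mult_left_mono)

lemma ell_infty_comp: "f \<in> ell_infty X \<Longrightarrow> \<phi> ` X \<subseteq> X \<Longrightarrow> f \<circ> \<phi> \<in> ell_infty X"
  unfolding ell_infty_def image_comp[symmetric] by (auto intro: bounded_subset)

text \<open>The permutations preserving \<open>\<mu>\<close> are closed under products and inverses,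
  so invariance need only be tested on generators. Products and the unit of
  \<open>BijGroup X\<close> are extensional and agree with composition and identity only on
  \<open>X\<close>; \<open>is_mean_ell_infty_cong\<close> bridges the difference.\<close>

lemma amenable_action_generated_perm_group_iff:
  assumes \<alpha>: "\<And>i. i \<in> I \<Longrightarrow> \<alpha> i \<in> carrier (BijGroup X)" and X: "X \<noteq> {}"
  shows "amenable_action (generated_perm_group X I \<alpha>) X (\<lambda>\<gamma>. \<gamma>) \<longleftrightarrow>
    (\<exists>\<mu>. is_mean X (ell_infty X) \<mu> \<and> (\<forall>f\<in>ell_infty X. \<forall>i\<in>I. \<mu> (f \<circ> \<alpha> i) = \<mu> f))"
    (is "?L \<longleftrightarrow> ?R")
proof
  assume ?L
  then obtain \<mu> where "is_mean X (ell_infty X) \<mu>"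
      "\<forall>f\<in>ell_infty X. \<forall>\<gamma>\<in>generate (BijGroup X) (\<alpha> ` I). \<mu> (f \<circ> \<gamma>) = \<mu> f"
    unfolding amenable_action_def generated_perm_group_def by auto
  moreover have "\<alpha> i \<in> generate (BijGroup X) (\<alpha> ` I)" if "i \<in> I" for i
    using that by (intro generate.incl) simp
  ultimately show ?R by blast
next
  assume ?R
  then obtain \<mu> where mean: "is_mean X (ell_infty X) \<mu>"
    and inv_gen: "\<And>f i. f \<in> ell_infty X \<Longrightarrow> i \<in> I \<Longrightarrow> \<mu> (f \<circ> \<alpha> i) = \<mu> f" by auto
  interpret S: group "BijGroup X" by (rule group_BijGroup)
  note cong = is_mean_ell_infty_cong[OF mean]
  have car: "carrier (BijGroup X) = Bij X" by (simp add: BijGroup_def)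
  have Bij_comp: "f \<circ> \<gamma> \<in> ell_infty X" if "\<gamma> \<in> Bij X" "f \<in> ell_infty X" for f \<gamma>
    using that by (intro ell_infty_comp) (auto simp: Bij_def bij_betw_def)
  have *: "\<gamma> \<in> Bij X \<and> (\<forall>f\<in>ell_infty X. \<mu> (f \<circ> \<gamma>) = \<mu> f)"
    if "\<gamma> \<in> generate (BijGroup X) (\<alpha> ` I)" for \<gamma>
    using that
  proof induction
    case one
    have "\<mu> (f \<circ> (\<lambda>x\<in>X. x)) = \<mu> f" if "f \<in> ell_infty X" for f
      by (rule cong[OF Bij_comp[OF id_Bij that] that]) simp
    moreover have "\<one>\<^bsub>BijGroup X\<^esub> = (\<lambda>x\<in>X. x)"
      by (simp add: BijGroup_def)
    ultimately show ?case using id_Bij[of X] by (simp only:) blast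
  next
    case (incl h)
    then obtain i where "i \<in> I" "h = \<alpha> i" by auto
    then show ?case using inv_gen \<alpha> car by (simp only:) blast
  next
    case (inv h)
    then obtain i where i: "i \<in> I" "h = \<alpha> i" by auto
    then have h: "h \<in> Bij X" using \<alpha> car by auto
    have h': "inv\<^bsub>BijGroup X\<^esub> h \<in> Bij X"
      using S.inv_closed h car by auto
    have "\<mu> (f \<circ> inv\<^bsub>BijGroup X\<^esub> h) = \<mu> f" if f: "f \<in> ell_infty X" for f
    proof -
      \<comment> \<open>Invariance under the generator \<open>h\<close> itself, used at
        \<open>f\<close> composed with the inverse of \<open>h\<close>.\<close>
      have "\<mu> (f \<circ> inv\<^bsub>BijGroup X\<^esub> h) = \<mu> (f \<circ> inv\<^bsub>BijGroup X\<^esub> h \<circ> h)"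
        using inv_gen[OF Bij_comp[OF h' f] i(1)] i(2) by (simp only:)
      also have "\<dots> = \<mu> f"
      proof (rule cong)
        show "f \<circ> inv\<^bsub>BijGroup X\<^esub> h \<circ> h \<in> ell_infty X"
          using Bij_comp[OF h Bij_comp[OF h' f]] .
        fix x assume x: "x \<in> X"
        then have "h x \<in> X" "inv_into X h (h x) = x"
          using h by (auto simp: Bij_def bij_betw_def)
        then show "(f \<circ> inv\<^bsub>BijGroup X\<^esub> h \<circ> h) x = f x"
          using h by (simp add: inv_BijGroup)
      qed fact
      finally show ?thesis .
    qed
    then show ?case using h' by blast
  next
    case (eng a b)
    have ab: "a \<otimes>\<^bsub>BijGroup X\<^esub> b = compose X a b"
      using eng.IH by (simp add: BijGroup_def)
    have "\<mu> (f \<circ> compose X a b) = \<mu> f" if f: "f \<in> ell_infty X" for f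
    proof -
      have "\<mu> (f \<circ> compose X a b) = \<mu> (f \<circ> a \<circ> b)"
        using Bij_comp[OF compose_Bij f, of a b] Bij_comp[OF _ Bij_comp[OF _ f], of b a] eng.IH
        by (intro cong) (simp_all add: compose_eq)
      also have "\<dots> = \<mu> (f \<circ> a)"
        using eng.IH Bij_comp[OF _ f] by blast
      also have "\<dots> = \<mu> f"
        using eng.IH f by blast
      finally show ?thesis .
    qed
    moreover have "compose X a b \<in> Bij X"
      using eng.IH by (intro compose_Bij) simp_all
    ultimately show ?case unfolding ab by blast
  qed
  show ?L
    unfolding amenable_action_def
    using group_action_generated_perm_group[OF \<alpha>] X mean *
    by (auto simp: generated_perm_group_def)
qed

section \<open>From perturbed translations to amenability\<close>

lemma RUC_b_iff:
  "f \<in> RUC_b \<longleftrightarrow> bounded (range f) \<and>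
     (\<forall>e>0. \<exists>U\<in>nbhds_neutral. \<forall>x y. x - y \<in> U \<longrightarrow> \<bar>f x - f y\<bar> < e)"
proof -
  have "(LIM (x, y) right_uniformity. (f x, f y) :> uniformity) \<longleftrightarrow>
      (\<forall>e>0. \<forall>\<^sub>F (x, y) in right_uniformity. \<bar>f x - f y\<bar> < e)"
    unfolding uniformity_dist filterlim_INF filterlim_principal
    by (auto simp: dist_real_def case_prod_unfold)
  also have "\<dots> \<longleftrightarrow> (\<forall>e>0. \<exists>U\<in>nbhds_neutral. \<forall>x y. x - y \<in> U \<longrightarrow> \<bar>f x - f y\<bar> < e)"
    (is "(\<forall>e>0. ?P e) \<longleftrightarrow> (\<forall>e>0. ?Q e)")
  proof -
    have "?P e \<longleftrightarrow> ?Q e" for e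
      using eventually_right_uniformity[of "{(x, y). \<bar>f x - f y\<bar> < e}"]
      by (simp add: case_prod_unfold subset_iff)
    then show ?thesis by simp
  qed
  finally show ?thesis by (simp add: RUC_b_def)
qed

lemma nbhds_neutral_Int: "U \<in> nbhds_neutral \<Longrightarrow> V \<in> nbhds_neutral \<Longrightarrow> U \<inter> V \<in> nbhds_neutral"
  by (auto simp: nbhds_neutral_def elim: eventually_elim2)

lemma zero_in_nbhds_neutral: "U \<in> nbhds_neutral \<Longrightarrow> 0 \<in> U"
  by (auto simp: nbhds_neutral_def dest: eventually_nhds_x_imp_x)

lemma RUC_b_const: "(\<lambda>_. c) \<in> RUC_b"
proof -
  have "UNIV \<in> nbhds_neutral" by (simp add: nbhds_neutral_def)
  then show ?thesis by (auto simp: RUC_b_iff)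
qed

lemma RUC_b_add:
  assumes "f \<in> RUC_b" "g \<in> RUC_b" shows "(\<lambda>x. f x + g x) \<in> RUC_b"
  unfolding RUC_b_iff
proof (intro conjI allI impI)
  show "bounded (range (\<lambda>x. f x + g x))"
    using assms by (auto simp: RUC_b_iff bounded_plus_comp)
  fix e :: real assume "e > 0"
  then have "e / 2 > 0" by simp
  then obtain U V where "U \<in> nbhds_neutral" "\<And>x y. x - y \<in> U \<Longrightarrow> \<bar>f x - f y\<bar> < e / 2"
      "V \<in> nbhds_neutral" "\<And>x y. x - y \<in> V \<Longrightarrow> \<bar>g x - g y\<bar> < e / 2"
    using assms unfolding RUC_b_iff by metis
  then have "\<forall>x y. x - y \<in> U \<inter> V \<longrightarrow> \<bar>f x + g x - (f y + g y)\<bar> < e"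
    by (smt (verit, best) Int_iff field_sum_of_halves)
  then show "\<exists>U\<in>nbhds_neutral. \<forall>x y. x - y \<in> U \<longrightarrow> \<bar>f x + g x - (f y + g y)\<bar> < e"
    using nbhds_neutral_Int \<open>U \<in> nbhds_neutral\<close> \<open>V \<in> nbhds_neutral\<close> by blast
qed

lemma RUC_b_scale:
  assumes "f \<in> RUC_b" shows "(\<lambda>x. c * f x) \<in> RUC_b"
proof (cases "c = 0")
  case True
  then show ?thesis using RUC_b_const[of 0] by simp
next
  case False
  show ?thesis
    unfolding RUC_b_iff
  proof (intro conjI allI impI)
    show "bounded (range (\<lambda>x. c * f x))"
      using assms ell_infty_scale[of f UNIV c] by (auto simp: RUC_b_iff ell_infty_def)
    fix e :: real assume "e > 0"
    with False have "e / \<bar>c\<bar> > 0" by simp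
    then obtain U where "U \<in> nbhds_neutral" "\<And>x y. x - y \<in> U \<Longrightarrow> \<bar>f x - f y\<bar> < e / \<bar>c\<bar>"
      using assms unfolding RUC_b_iff by metis
    then show "\<exists>U\<in>nbhds_neutral. \<forall>x y. x - y \<in> U \<longrightarrow> \<bar>c * f x - c * f y\<bar> < e"
      using False
      by (intro bexI[of _ U]) (auto simp: right_diff_distrib[symmetric] abs_mult pos_less_divide_eq mult.commute)
  qed
qed

text \<open>Continuity of conjugation at \<open>0\<close>. It is needed since left translation turns
  \<open>x - y\<close> into \<open>g + x - (g + y)\<close>, the conjugate of \<open>x - y\<close> by
  \<open>g\<close>.\<close>

lemma nhds_neutral_conjugate:
  fixes g :: "'a::topological_group_add"
  assumes "U \<in> nbhds_neutral"
  shows "{x. g + x - g \<in> U} \<in> nbhds_neutral"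
proof -
  have "((\<lambda>x. g + x - g) \<longlongrightarrow> g + 0 - g) (nhds 0)"
    unfolding diff_conv_add_uminus
    by (intro tendsto_add tendsto_const) (simp add: filterlim_ident)
  then show ?thesis
    using assms by (auto simp: nbhds_neutral_def filterlim_iff)
qed

lemma RUC_b_translate:
  fixes f :: "'a::topological_group_add \<Rightarrow> real"
  assumes "f \<in> RUC_b" shows "f \<circ> (\<lambda>x. g + x) \<in> RUC_b"
  unfolding RUC_b_iff
proof (intro conjI allI impI)
  show "bounded (range (f \<circ> (\<lambda>x. g + x)))"
    using assms by (auto simp: RUC_b_iff intro: bounded_subset)
  fix e :: real assume "e > 0"
  then obtain U where U: "U \<in> nbhds_neutral" "\<And>x y. x - y \<in> U \<Longrightarrow> \<bar>f x - f y\<bar> < e"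
    using assms unfolding RUC_b_iff by metis
  have "\<bar>f (g + x) - f (g + y)\<bar> < e" if "g + (x - y) - g \<in> U" for x y
  proof -
    have "g + x - (g + y) = g + (x - y) - g"
      by (simp only: diff_conv_add_uminus minus_add add.assoc)
    with that U(2)[of "g + x" "g + y"] show ?thesis by (simp only:)
  qed
  then show "\<exists>U\<in>nbhds_neutral. \<forall>x y. x - y \<in> U \<longrightarrow>
      \<bar>(f \<circ> (+) g) x - (f \<circ> (+) g) y\<bar> < e"
    using nhds_neutral_conjugate[OF U(1), of g] by (intro bexI) auto
qed

section \<open>Passing from almost invariant means to amenability\<close>

lemma perturbed_translations_iff:
  "\<alpha> \<in> perturbed_translations U \<longleftrightarrow> (\<forall>g. bij (\<alpha> g)) \<and> (\<forall>g h. \<alpha> g h - (g + h) \<in> U)"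
proof -
  have "\<alpha> g h \<in> (\<lambda>u. u + g + h) ` U \<longleftrightarrow> \<alpha> g h - (g + h) \<in> U" for g h
  proof -
    have "x = u + g + h \<longleftrightarrow> x - (g + h) = u" for x u :: 'a
      by (metis add.assoc add_diff_cancel diff_add_cancel)
    then show ?thesis by (auto simp: image_iff)
  qed
  then show ?thesis
    by (simp add: perturbed_translations_def BijGroup_def Bij_def)
qed

text \<open>Common core of the two implications towards amenability: \<open>p U\<close> maps the set
  acted on to the group (identity or first projection) and intertwines \<open>\<tau> U g\<close>
  with translation by \<open>g\<close> up to an error in \<open>U\<close>. For \<open>f\<close> in
  \<open>RUC_b\<close>, pulling back the translate of \<open>f\<close> and moving the pullback of
  \<open>f\<close> by \<open>\<tau> U g\<close> differ uniformly little once \<open>U\<close> is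
  small, so the pulled-back means become invariant in the limit.\<close>

lemma amenable_if_almost_invariant_means:
  fixes p :: "'a::topological_group_add set \<Rightarrow> 'x \<Rightarrow> 'a" and X :: "'a set \<Rightarrow> 'x set"
    and \<tau> :: "'a set \<Rightarrow> 'a \<Rightarrow> 'x \<Rightarrow> 'x"
  assumes mean: "\<And>U. U \<in> nbhds_neutral \<Longrightarrow> is_mean (X U) (ell_infty (X U)) (\<nu> U)"
    and X: "\<And>U g x. U \<in> nbhds_neutral \<Longrightarrow> x \<in> X U \<Longrightarrow> \<tau> U g x \<in> X U"
    and inv: "\<And>U f g. U \<in> nbhds_neutral \<Longrightarrow> f \<in> ell_infty (X U) \<Longrightarrow> \<nu> U (f \<circ> \<tau> U g) = \<nu> U f"
    and near: "\<And>U g x. U \<in> nbhds_neutral \<Longrightarrow> x \<in> X U \<Longrightarrow> p U (\<tau> U g x) - (g + p U x) \<in> U"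
  shows "amenable_topological_group TYPE('a)"
proof -
  \<comment> \<open>The filter of neighbourhoods shrinking to \<open>0\<close>: a property holds
    eventually if it holds for all neighbourhoods inside some fixed one.\<close>
  define \<Phi> :: "'a set filter"
    where "\<Phi> = (INF V\<in>nbhds_neutral. principal {U\<in>nbhds_neutral. U \<subseteq> V})"
  have U0: "UNIV \<in> (nbhds_neutral :: 'a set set)" by (simp add: nbhds_neutral_def)
  have ev: "eventually P \<Phi> \<longleftrightarrow> (\<exists>V\<in>nbhds_neutral. \<forall>U\<in>nbhds_neutral. U \<subseteq> V \<longrightarrow> P U)" for P
    unfolding \<Phi>_def
  proof (subst eventually_INF_base)
    show "nbhds_neutral \<noteq> ({} :: 'a set set)" using U0 by auto
    fix a b :: "'a set" assume "a \<in> nbhds_neutral" "b \<in> nbhds_neutral"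
    then show "\<exists>x\<in>nbhds_neutral. principal {U \<in> nbhds_neutral. U \<subseteq> x}
        \<le> inf (principal {U \<in> nbhds_neutral. U \<subseteq> a}) (principal {U \<in> nbhds_neutral. U \<subseteq> b})"
      by (intro bexI[of _ "a \<inter> b"]) (auto simp: nbhds_neutral_Int)
  qed (auto simp: eventually_principal)
  have \<Phi>: "\<Phi> \<noteq> bot"
    unfolding trivial_limit_def ev by auto
  \<comment> \<open>The fallback to \<open>UNIV\<close> makes \<open>m U\<close> a mean for every
    set \<open>U\<close>, since \<open>is_mean_limit\<close> admits no exceptional indices.\<close>
  define m where "m U f = (if U \<in> nbhds_neutral then \<nu> U (f \<circ> p U)
      else \<nu> UNIV (f \<circ> p UNIV))" for U f
  have comp: "f \<circ> p U \<in> ell_infty (X U)" if "f \<in> RUC_b" for f U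
    using that unfolding ell_infty_def RUC_b_iff by (auto intro: bounded_subset)
  have mean_pull: "is_mean UNIV RUC_b (\<lambda>f. \<nu> U (f \<circ> p U))" if U: "U \<in> nbhds_neutral" for U
    unfolding is_mean_def
  proof (intro conjI ballI allI impI)
    note m = mean[OF U]
    fix f g :: "'a \<Rightarrow> real" and c assume f: "f \<in> RUC_b" 
    show "\<nu> U ((\<lambda>x. c * f x) \<circ> p U) = c * \<nu> U (f \<circ> p U)"
      using is_mean_scale[OF m comp[OF f], of c] by (simp add: o_def)
    show "\<nu> U ((\<lambda>x. f x + g x) \<circ> p U) = \<nu> U (f \<circ> p U) + \<nu> U (g \<circ> p U)" if "g \<in> RUC_b"
      using is_mean_add[OF m comp[OF f] comp[OF that]] by (simp add: o_def)
    show "0 \<le> \<nu> U (f \<circ> p U)" if "\<forall>x\<in>UNIV. 0 \<le> f x"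
      using that by (intro is_mean_nonneg[OF m comp[OF f]]) simp
  next
    show "\<nu> U ((\<lambda>x. 1) \<circ> p U) = 1"
      using is_mean_one[OF mean[OF U]] by (simp add: o_def)
  qed
  have mean_m: "is_mean UNIV RUC_b (m U)" for U
    using mean_pull[of U] mean_pull[OF U0] by (cases "U \<in> nbhds_neutral") (simp_all add: m_def[abs_def])
  have bdd: "bounded (range f)" if "f \<in> RUC_b" for f :: "'a \<Rightarrow> real"
    using that by (simp add: RUC_b_def)
  obtain M where M: "is_mean UNIV RUC_b M"
    "\<And>f g. f \<in> RUC_b \<Longrightarrow> g \<in> RUC_b \<Longrightarrow> ((\<lambda>i. m i f - m i g) \<longlongrightarrow> 0) \<Phi> \<Longrightarrow> M f = M g"
    using is_mean_limit[of UNIV RUC_b m \<Phi>, OF mean_m RUC_b_const RUC_b_add RUC_b_scale bdd \<Phi>]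
    by blast
  have "M (f \<circ> (\<lambda>x. g + x)) = M f" if f: "f \<in> RUC_b" for f g
  proof (rule M(2)[OF RUC_b_translate[OF f] f], rule tendstoI)
    fix e :: real assume "e > 0"
    then have "e / 2 > 0" by simp
    then obtain V where V: "V \<in> nbhds_neutral" "\<And>x y. x - y \<in> V \<Longrightarrow> \<bar>f x - f y\<bar> < e / 2"
      using f unfolding RUC_b_iff by metis
    show "eventually (\<lambda>U. dist (m U (f \<circ> (\<lambda>x. g + x)) - m U f) 0 < e) \<Phi>"
      unfolding ev
    proof (intro bexI[OF _ V(1)] ballI impI)
      fix U assume U: "U \<in> nbhds_neutral" "U \<subseteq> V"
      note m = mean[OF U(1)]
      note bnd = is_mean_bound[OF m _ ell_infty_const ell_infty_add ell_infty_scale]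
      define h where "h = f \<circ> p U"
      define k where "k = f \<circ> (\<lambda>x. g + x) \<circ> p U"
      have h: "h \<in> ell_infty (X U)" "h \<circ> \<tau> U g \<in> ell_infty (X U)" 
        unfolding h_def using X[OF U(1)] by (auto intro!: comp[OF f] ell_infty_comp)
      have k: "k \<in> ell_infty (X U)"
        unfolding k_def by (intro comp RUC_b_translate f)
      have close: "\<bar>k x - (h \<circ> \<tau> U g) x\<bar> \<le> e / 2" if "x \<in> X U" for x
      proof -
        have "\<bar>f (p U (\<tau> U g x)) - f (g + p U x)\<bar> < e / 2"
          using V(2) near[OF U(1) that, of g] U(2) by blast
        then show ?thesis by (simp add: k_def h_def abs_minus_commute)
      qed
      have diff: "\<nu> U a - \<nu> U b \<le> e / 2"
        if a: "a \<in> ell_infty (X U)" and b: "b \<in> ell_infty (X U)"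
          and ab: "\<And>x. x \<in> X U \<Longrightarrow> a x - b x \<le> e / 2" for a b
      proof -
        have "\<nu> U (\<lambda>x. a x + (-1) * b x) \<le> e / 2"
          using ab by (intro bnd ell_infty_add ell_infty_scale a b) auto
        then show ?thesis
          using is_mean_add[OF m a ell_infty_scale[OF b, of "-1"]] is_mean_scale[OF m b, of "-1"] by simp
      qed
      have "\<nu> U k - \<nu> U (h \<circ> \<tau> U g) \<le> e / 2"
        by (rule diff[OF k h(2)]) (rule abs_le_D1[OF close])
      moreover have "\<nu> U (h \<circ> \<tau> U g) - \<nu> U k \<le> e / 2"
        by (rule diff[OF h(2) k]) (metis abs_le_D1 abs_minus_commute close)
      moreover have "\<nu> U (h \<circ> \<tau> U g) = \<nu> U h" by (rule inv[OF U(1) h(1)])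
      ultimately have "\<bar>\<nu> U k - \<nu> U h\<bar> \<le> e / 2" unfolding abs_le_iff by linarith
      then show "dist (m U (f \<circ> (\<lambda>x. g + x)) - m U f) 0 < e"
        using U(1) \<open>e > 0\<close> by (simp add: m_def k_def h_def dist_real_def)
    qed
  qed
  with M(1) show ?thesis unfolding amenable_topological_group_def by blast
qed

section \<open>The two permutation actions and their invariant means\<close>

lemma amenable_action_perturbed_iff:
  fixes \<alpha> :: "'a::topological_group_add \<Rightarrow> 'a \<Rightarrow> 'a"
  assumes "\<alpha> \<in> perturbed_translations U"
  shows "amenable_action (generated_perm_group UNIV UNIV \<alpha>) UNIV (\<lambda>\<gamma>. \<gamma>) \<longleftrightarrow>
    (\<exists>\<mu>. is_mean UNIV (ell_infty UNIV) \<mu> \<and> (\<forall>f\<in>ell_infty UNIV. \<forall>g. \<mu> (f \<circ> \<alpha> g) = \<mu> f))"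
  using assms amenable_action_generated_perm_group_iff[of UNIV \<alpha> UNIV]
  by (simp add: perturbed_translations_def)

lemma amenable_action_Gamma_U_iff:
  fixes U :: "'a::topological_group_add set"
  assumes "perturbed_translations U \<noteq> {}"
  shows "amenable_action (Gamma_U U) (UNIV \<times> perturbed_translations U) (\<lambda>\<gamma>. \<gamma>) \<longleftrightarrow>
    (\<exists>\<mu>. is_mean (UNIV \<times> perturbed_translations U) (ell_infty (UNIV \<times> perturbed_translations U)) \<mu> \<and>
      (\<forall>f\<in>ell_infty (UNIV \<times> perturbed_translations U). \<forall>g.
        \<mu> (f \<circ> perm_direct_sum UNIV (perturbed_translations U) (\<lambda>\<alpha>. \<alpha>) g) = \<mu> f))"
  unfolding Gamma_U_def using assms
  by (subst amenable_action_generated_perm_group_iff)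
     (auto intro!: perm_direct_sum_in_Sym simp: perturbed_translations_def)

lemma amenable_if_perturbed_actions_amenable:
  assumes "\<forall>U\<in>(nbhds_neutral :: 'a::topological_group_add set set). \<exists>\<alpha>\<in>perturbed_translations U.
      amenable_action (generated_perm_group UNIV UNIV \<alpha>) UNIV (\<lambda>\<gamma>. \<gamma>)"
  shows "amenable_topological_group TYPE('a)"
proof -
  have "\<forall>U\<in>(nbhds_neutral :: 'a set set). \<exists>\<alpha> \<mu>. \<alpha> \<in> perturbed_translations U \<and>
      is_mean UNIV (ell_infty UNIV) \<mu> \<and> (\<forall>f\<in>ell_infty UNIV. \<forall>g. \<mu> (f \<circ> \<alpha> g) = \<mu> f)"
  proof
    fix U :: "'a set" assume "U \<in> nbhds_neutral"
    then obtain \<alpha> where "\<alpha> \<in> perturbed_translations U"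
        "amenable_action (generated_perm_group UNIV UNIV \<alpha>) UNIV (\<lambda>\<gamma>. \<gamma>)"
      using assms by blast
    then show "\<exists>\<alpha> \<mu>. \<alpha> \<in> perturbed_translations U \<and>
      is_mean UNIV (ell_infty UNIV) \<mu> \<and> (\<forall>f\<in>ell_infty UNIV. \<forall>g. \<mu> (f \<circ> \<alpha> g) = \<mu> f)"
      using amenable_action_perturbed_iff by blast
  qed
  then obtain \<alpha> \<mu> where *: "\<And>U. U \<in> nbhds_neutral \<Longrightarrow> \<alpha> U \<in> perturbed_translations U"
      "\<And>U::'a set. U \<in> nbhds_neutral \<Longrightarrow> is_mean UNIV (ell_infty UNIV) (\<mu> U)"
      "\<And>U f g. U \<in> nbhds_neutral \<Longrightarrow> f \<in> ell_infty UNIV \<Longrightarrow> \<mu> U (f \<circ> \<alpha> U g) = \<mu> U f"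
    by metis
  show ?thesis
    using * by (intro amenable_if_almost_invariant_means[of "\<lambda>_. UNIV" \<mu> \<alpha> "\<lambda>_ x. x"])
      (auto simp: perturbed_translations_iff)
qed

lemma amenable_if_Gamma_U_actions_amenable:
  assumes "\<forall>U\<in>(nbhds_neutral :: 'a::topological_group_add set set).
      amenable_action (Gamma_U U) (UNIV \<times> perturbed_translations U) (\<lambda>\<gamma>. \<gamma>)"
  shows "amenable_topological_group TYPE('a)"
proof -
  let ?N = "perturbed_translations :: 'a set \<Rightarrow> _"
  have "\<forall>U\<in>(nbhds_neutral :: 'a set set). \<exists>\<mu>.
      is_mean (UNIV \<times> ?N U) (ell_infty (UNIV \<times> ?N U)) \<mu> \<and>
      (\<forall>f\<in>ell_infty (UNIV \<times> ?N U). \<forall>g. \<mu> (f \<circ> perm_direct_sum UNIV (?N U) (\<lambda>\<alpha>. \<alpha>) g) = \<mu> f)"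
  proof
    fix U :: "'a set" assume "U \<in> nbhds_neutral"
    then have am: "amenable_action (Gamma_U U) (UNIV \<times> ?N U) (\<lambda>\<gamma>. \<gamma>)"
      using assms by blast
    \<comment> \<open>Amenability of an action includes non-emptiness of the set, which excludes an
      empty index set.\<close>
    moreover from am have "?N U \<noteq> {}" by (auto simp: amenable_action_def)
    ultimately show "\<exists>\<mu>. is_mean (UNIV \<times> ?N U) (ell_infty (UNIV \<times> ?N U)) \<mu> \<and>
      (\<forall>f\<in>ell_infty (UNIV \<times> ?N U). \<forall>g. \<mu> (f \<circ> perm_direct_sum UNIV (?N U) (\<lambda>\<alpha>. \<alpha>) g) = \<mu> f)"
      by (simp add: amenable_action_Gamma_U_iff)
  qed
  then obtain \<mu> where *:
      "\<And>U::'a set. U \<in> nbhds_neutral \<Longrightarrow> is_mean (UNIV \<times> ?N U) (ell_infty (UNIV \<times> ?N U)) (\<mu> U)"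
      "\<And>U f g. U \<in> nbhds_neutral \<Longrightarrow> f \<in> ell_infty (UNIV \<times> ?N U) \<Longrightarrow>
        \<mu> U (f \<circ> perm_direct_sum UNIV (?N U) (\<lambda>\<alpha>. \<alpha>) g) = \<mu> U f"
    by metis
  show ?thesis
    by (rule amenable_if_almost_invariant_means[of "\<lambda>U. UNIV \<times> ?N U" \<mu>
          "\<lambda>U. perm_direct_sum UNIV (?N U) (\<lambda>\<alpha>. \<alpha>)" "\<lambda>_. fst"])
      (use * in \<open>auto simp: perm_direct_sum_def perturbed_translations_iff\<close>)
qed

text \<open>The direct sum maps the slice over \<open>\<alpha>\<close> to itself and acts there as
  \<open>\<alpha> g\<close>, so evaluating \<open>\<mu>\<close> on that slice gives an invariant
  mean.\<close>

lemma Gamma_U_action_amenable: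
  fixes \<alpha> :: "'a::topological_group_add \<Rightarrow> 'a \<Rightarrow> 'a"
  assumes \<alpha>: "\<alpha> \<in> perturbed_translations U"
    and am: "amenable_action (generated_perm_group UNIV UNIV \<alpha>) UNIV (\<lambda>\<gamma>. \<gamma>)"
  shows "amenable_action (Gamma_U U) (UNIV \<times> perturbed_translations U) (\<lambda>\<gamma>. \<gamma>)"
proof -
  let ?X = "UNIV \<times> perturbed_translations U"
  obtain \<mu> where mean: "is_mean UNIV (ell_infty UNIV) \<mu>"
    and inv: "\<And>f g. f \<in> ell_infty UNIV \<Longrightarrow> \<mu> (f \<circ> \<alpha> g) = \<mu> f"
    using am amenable_action_perturbed_iff[OF \<alpha>] by blast
  have slice: "(\<lambda>x. f (x, \<alpha>)) \<in> ell_infty UNIV" if "f \<in> ell_infty ?X" for f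
    using that \<alpha> unfolding ell_infty_def by (auto intro: bounded_subset)
  have "is_mean ?X (ell_infty ?X) (\<lambda>f. \<mu> (\<lambda>x. f (x, \<alpha>)))"
    unfolding is_mean_def
    using is_mean_add[OF mean slice slice] is_mean_scale[OF mean slice] is_mean_one[OF mean]
      is_mean_nonneg[OF mean slice] \<alpha> by simp
  moreover have "\<mu> (\<lambda>x. (f \<circ> perm_direct_sum UNIV (perturbed_translations U) (\<lambda>\<alpha>. \<alpha>) g) (x, \<alpha>))
      = \<mu> (\<lambda>x. f (x, \<alpha>))" if "f \<in> ell_infty ?X" for f g
    using inv[OF slice[OF that], of g] \<alpha> by (simp add: perm_direct_sum_def o_def)
  ultimately show ?thesis
    using \<alpha> by (subst amenable_action_Gamma_U_iff) auto
qed

section \<open>Invariant pseudonorms\<close>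

text \<open>Continuity of the triple sum at the origin, followed by intersecting with the negatives.
  Three summands are what the splitting of a chain into left part, middle entry and right part
  uses.\<close>

lemma nbhds_neutral_symmetric_cube:
  fixes U :: "'a::topological_group_add set"
  assumes "U \<in> nbhds_neutral"
  obtains W where "W \<in> nbhds_neutral" "\<And>x. x \<in> W \<Longrightarrow> - x \<in> W"
    "\<And>x y z. x \<in> W \<Longrightarrow> y \<in> W \<Longrightarrow> z \<in> W \<Longrightarrow> x + y + z \<in> U"
proof -
  have U: "eventually (\<lambda>x. x \<in> U) (nhds (0 + 0 + 0))"
    using assms by (simp add: nbhds_neutral_def)
  have "((\<lambda>(x, y, z). x + y + z) \<longlongrightarrow> (0::'a) + 0 + 0) (nhds 0 \<times>\<^sub>F nhds 0 \<times>\<^sub>F nhds 0)"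
    unfolding case_prod_unfold
    by (intro tendsto_add) (auto intro: filterlim_fst filterlim_snd filterlim_compose)
  then have "eventually (\<lambda>(x, y, z). x + y + z \<in> U) (nhds 0 \<times>\<^sub>F nhds 0 \<times>\<^sub>F nhds (0::'a))"
    using U by (auto simp: filterlim_iff case_prod_unfold)
  then obtain P Q R where P: "eventually P (nhds 0)" "eventually Q (nhds 0)" "eventually R (nhds 0)"
    and PQR: "\<And>x y z. P x \<Longrightarrow> Q y \<Longrightarrow> R z \<Longrightarrow> x + y + z \<in> U"
    unfolding eventually_prod_filter by (auto 0 4)
  define W' where "W' = {x. P x \<and> Q x \<and> R x}"
  define W where "W = {x \<in> W'. - x \<in> W'}"
  have ev: "eventually (\<lambda>x. x \<in> W') (nhds 0)"
    using P by (auto simp: W'_def eventually_conj_iff)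
  have "((\<lambda>x. - x) \<longlongrightarrow> 0) (nhds (0::'a))"
    using tendsto_uminus_nhds[of "0::'a"] by simp
  then have "eventually (\<lambda>x. - x \<in> W') (nhds 0)"
    using ev by (auto simp: filterlim_iff)
  with ev have "W \<in> nbhds_neutral"
    by (simp add: W_def nbhds_neutral_def eventually_conj_iff)
  then show thesis
    by (rule that) (auto simp: W_def W'_def intro: PQR)
qed

text \<open>\<open>x\<close> is the entry at which the partial sums first reach \<open>c\<close>.
  With \<open>c\<close> half of the total, both outer pieces get at most half of it.\<close>

lemma sum_list_split_at:
  fixes f :: "'a \<Rightarrow> real"
  assumes "xs \<noteq> []" "0 \<le> c" "c \<le> (\<Sum>x\<leftarrow>xs. f x)"
  shows "\<exists>ys x zs. xs = ys @ x # zs \<and> (\<Sum>x\<leftarrow>ys. f x) \<le> c \<and> c \<le> (\<Sum>x\<leftarrow>ys. f x) + f x"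
  using assms
proof (induction xs arbitrary: c)
  case (Cons a xs)
  show ?case
  proof (cases "c \<le> f a \<or> xs = []")
    case True
    with Cons.prems show ?thesis by (intro exI[of _ "[]"] exI[of _ a] exI[of _ xs]) auto
  next
    case False
    with Cons obtain ys x zs where "xs = ys @ x # zs" "(\<Sum>x\<leftarrow>ys. f x) \<le> c - f a"
        "c - f a \<le> (\<Sum>x\<leftarrow>ys. f x) + f x"
      using Cons.IH[of "c - f a"] by (auto simp: algebra_simps)
    then show ?thesis by (intro exI[of _ "a # ys"] exI[of _ x] exI[of _ zs]) auto
  qed
qed simp

text \<open>The Birkhoff--Kakutani chain construction.\<close>

lemma nbhds_neutral_pseudonorm:
  fixes V :: "'a::topological_group_add set"
  assumes "V \<in> nbhds_neutral"
  obtains \<omega> :: "'a \<Rightarrow> real" where "\<omega> 0 = 0" "\<And>x. 0 \<le> \<omega> x" "\<And>x. \<omega> (- x) = \<omega> x"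
    "\<And>x y. \<omega> (x + y) \<le> \<omega> x + \<omega> y" "(\<omega> \<longlongrightarrow> 0) (nhds 0)" "\<And>x. \<omega> x < 1 \<Longrightarrow> x \<in> V"
proof -
  define good where "good W \<longleftrightarrow> W \<in> nbhds_neutral \<and> (\<forall>x\<in>W. - x \<in> W)" for W :: "'a set"
  obtain V0 where V0: "good V0" "\<And>x y z. x \<in> V0 \<Longrightarrow> y \<in> V0 \<Longrightarrow> z \<in> V0 \<Longrightarrow> x + y + z \<in> V"
    using nbhds_neutral_symmetric_cube[OF assms] unfolding good_def by metis
  have "\<exists>W'. good W' \<and> (\<forall>x\<in>W'. \<forall>y\<in>W'. \<forall>z\<in>W'. x + y + z \<in> W)" if "good W" for W
    using nbhds_neutral_symmetric_cube[of W] that unfolding good_def by metis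
  \<comment> \<open>Triples from \<open>W (Suc n)\<close> sum into \<open>W n\<close>; the clause
    for \<open>n = 0\<close> in the dependent choice fixes the first set to
    \<open>V0\<close>.\<close>
  then obtain W where W: "\<And>n. good (W n)" "W 0 = V0"
      "\<And>n x y z. x \<in> W (Suc n) \<Longrightarrow> y \<in> W (Suc n) \<Longrightarrow> z \<in> W (Suc n) \<Longrightarrow> x + y + z \<in> W n"
    using dependent_nat_choice[of "\<lambda>n X. good X \<and> (n = 0 \<longrightarrow> X = V0)"
        "\<lambda>n X Y. \<forall>x\<in>Y. \<forall>y\<in>Y. \<forall>z\<in>Y. x + y + z \<in> X"] V0(1) by (metis nat.distinct(1))
  have W0: "0 \<in> W n" for n
    using W(1)[of n] zero_in_nbhds_neutral by (auto simp: good_def)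
  have neg: "- x \<in> W n \<longleftrightarrow> x \<in> W n" for x n
    using W(1)[of n] by (metis good_def minus_minus)
  have W_Suc: "W (Suc n) \<subseteq> W n" for n
    using W(3)[of _ n 0 0] W0 by auto
  have mono: "W n \<subseteq> W m" if "m \<le> n" for m n
    using lift_Suc_antimono_le[of W] W_Suc that by blast
  \<comment> \<open>The exponent is the first level that \<open>x\<close> fails to reach, so that
    \<open>\<delta> x < (1/2) ^ n\<close> detects membership in \<open>W n\<close> exactly.\<close>
  define \<delta> :: "'a \<Rightarrow> real"
    where "\<delta> x = (if \<forall>n. x \<in> W n then 0 else (1/2) ^ (LEAST n. x \<notin> W n))" for x
  have \<delta>_nonneg: "0 \<le> \<delta> x" for x by (simp add: \<delta>_def)
  have \<delta>_neg: "\<delta> (- x) = \<delta> x" for x by (simp add: \<delta>_def neg)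
  have \<delta>_less: "\<delta> x < (1/2) ^ n \<longleftrightarrow> x \<in> W n" for x n
  proof (cases "\<forall>n. x \<in> W n")
    case False
    define N where "N = (LEAST n. x \<notin> W n)"
    have N: "x \<notin> W N"
      unfolding N_def by (rule LeastI_ex) (use False in blast)
    have less: "x \<in> W k" if "k < N" for k
      using not_less_Least[of k "\<lambda>n. x \<notin> W n"] that by (simp add: N_def)
    have "\<delta> x = (1/2) ^ N" using False by (simp add: \<delta>_def N_def)
    moreover have "x \<in> W n \<longleftrightarrow> n < N"
      using N less[of n] mono[of N n] by (cases "n < N") auto
    moreover have "(1/2::real) ^ N < (1/2) ^ n \<longleftrightarrow> n < N"
      by (rule power_strict_decreasing_iff) simp_all
    ultimately show ?thesis by (simp only:)
  next
    case True
    then show ?thesis by (auto simp: \<delta>_def)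
  qed
  \<comment> \<open>Induction on the length: cutting at half of the total weight \<open>s\<close>
    leaves outer pieces weighing at most \<open>s / 2\<close>, so by induction their sums lie in
    \<open>W (Suc n)\<close>, as does the middle entry by \<open>\<delta>_less\<close>. The triple
    property then lands in \<open>W n\<close>.\<close>
  have chain: "sum_list xs \<in> W n" if "(\<Sum>x\<leftarrow>xs. \<delta> x) < (1/2) ^ Suc n" for xs n
    using that
  proof (induction xs arbitrary: n rule: length_induct)
    case (1 xs)
    show ?case
    proof (cases "xs = []")
      case False
      define s where "s = (\<Sum>x\<leftarrow>xs. \<delta> x)"
      have s: "s < (1/2) ^ Suc n" "0 \<le> s"
        using 1(2) \<delta>_nonneg by (auto simp: s_def intro!: sum_list_nonneg)
      then obtain ys x zs where split: "xs = ys @ x # zs" "(\<Sum>x\<leftarrow>ys. \<delta> x) \<le> s / 2"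
          "s / 2 \<le> (\<Sum>x\<leftarrow>ys. \<delta> x) + \<delta> x"
        using sum_list_split_at[OF False, of "s / 2" \<delta>] by (auto simp: s_def)
      have s_eq: "s = (\<Sum>x\<leftarrow>ys. \<delta> x) + \<delta> x + (\<Sum>x\<leftarrow>zs. \<delta> x)"
        using split(1) by (simp add: s_def)
      have nonneg: "0 \<le> (\<Sum>x\<leftarrow>ys. \<delta> x)" "0 \<le> (\<Sum>x\<leftarrow>zs. \<delta> x)"
        using \<delta>_nonneg by (auto intro!: sum_list_nonneg)
      have "(\<Sum>x\<leftarrow>ys. \<delta> x) < (1/2) ^ Suc (Suc n)" "(\<Sum>x\<leftarrow>zs. \<delta> x) < (1/2) ^ Suc (Suc n)"
        "\<delta> x < (1/2) ^ Suc n"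
        using s split s_eq nonneg by simp_all
      moreover have "length ys < length xs" "length zs < length xs"
        using split(1) by simp_all
      ultimately have "sum_list ys \<in> W (Suc n)" "sum_list zs \<in> W (Suc n)" "x \<in> W (Suc n)"
        using 1(1) \<delta>_less by blast+
      then show ?thesis
        using W(3) split(1) by (simp add: add.assoc)
    qed (use W0 in simp)
  qed
  \<comment> \<open>The infimum over all decompositions of \<open>x\<close> makes
    \<open>\<rho>\<close> subadditive, while \<open>chain\<close> prevents it from becoming too
    small outside \<open>V\<close>.\<close>
  define D where "D x = (\<lambda>xs. \<Sum>y\<leftarrow>xs. \<delta> y) ` {xs. sum_list xs = x}" for x
  define \<rho> where "\<rho> x = Inf (D x)" for x
  have D_nonneg: "0 \<le> d" if "d \<in> D x" for d x
    using that \<delta>_nonneg by (auto simp: D_def intro!: sum_list_nonneg)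
  have bdd: "bdd_below (D x)" for x
    using D_nonneg by (auto simp: bdd_below_def)
  have \<delta>_in: "\<delta> x \<in> D x" for x
    unfolding D_def by (rule image_eqI[of _ _ "[x]"]) simp_all
  have ne: "D x \<noteq> {}" for x using \<delta>_in by blast
  have \<rho>_le: "\<rho> x \<le> d" if "d \<in> D x" for d x
    unfolding \<rho>_def by (rule cInf_lower[OF that bdd])
  have \<rho>_nonneg: "0 \<le> \<rho> x" for x
    unfolding \<rho>_def by (rule cInf_greatest[OF ne D_nonneg])
  have \<rho>_approx: "\<exists>d\<in>D x. d < c" if "\<rho> x < c" for x c
    using that cInf_less_iff[OF ne bdd] unfolding \<rho>_def by blast
  have \<rho>_0: "\<rho> 0 = 0"
    using \<rho>_le[OF \<delta>_in, of 0] \<rho>_nonneg[of 0] by (simp add: \<delta>_def W0)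
  \<comment> \<open>Negation reverses the order of the summands, since the group need not be
    commutative.\<close>
  have uminus_sum_list: "sum_list (rev (map uminus xs)) = - sum_list xs" for xs :: "'a list"
    by (induction xs) (simp_all add: minus_add)
  have D_neg: "d \<in> D (- x)" if "d \<in> D x" for d x
  proof -
    from that obtain xs where xs: "d = (\<Sum>y\<leftarrow>xs. \<delta> y)" "sum_list xs = x" by (auto simp: D_def)
    have "(\<Sum>y\<leftarrow>rev (map uminus xs). \<delta> y) = d"
      unfolding xs(1) rev_map[symmetric] sum_list_rev by (simp add: o_def \<delta>_neg)
    with xs(2) uminus_sum_list[of xs] show ?thesis
      unfolding D_def by (intro image_eqI[of _ _ "rev (map uminus xs)"]) simp_all
  qed
  have \<rho>_neg: "\<rho> (- x) = \<rho> x" for x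
    using D_neg[of _ x] D_neg[of _ "- x"] by (auto simp: \<rho>_def intro!: arg_cong[where f = Inf])
  have \<rho>_add: "\<rho> (x + y) \<le> \<rho> x + \<rho> y" for x y
  proof (rule field_le_epsilon)
    fix e :: real assume "e > 0"
    then obtain a b where ab: "a \<in> D x" "a < \<rho> x + e / 2" "b \<in> D y" "b < \<rho> y + e / 2"
      using \<rho>_approx[of x "\<rho> x + e / 2"] \<rho>_approx[of y "\<rho> y + e / 2"] by auto
    then obtain xs ys where "a = (\<Sum>y\<leftarrow>xs. \<delta> y)" "sum_list xs = x"
        "b = (\<Sum>y\<leftarrow>ys. \<delta> y)" "sum_list ys = y"
      by (auto simp: D_def)
    then have "a + b \<in> D (x + y)"
      unfolding D_def by (intro image_eqI[of _ _ "xs @ ys"]) simp_all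
    then show "\<rho> (x + y) \<le> \<rho> x + \<rho> y + e"
      using \<rho>_le[of "a + b" "x + y"] ab by simp
  qed
  have \<rho>_V: "x \<in> V" if "\<rho> x < 1/2" for x
  proof -
    from \<rho>_approx[OF that] obtain xs where "(\<Sum>y\<leftarrow>xs. \<delta> y) < 1/2" "sum_list xs = x"
      by (auto simp: D_def)
    then have "x \<in> V0" using chain[of xs 0] W(2) by simp
    then show ?thesis using V0(2)[of x 0 0] W0[of 0] W(2) by simp
  qed
  have lim: "(\<rho> \<longlongrightarrow> 0) (nhds 0)"
  proof (rule tendstoI)
    fix e :: real assume "e > 0"
    then obtain n where n: "(1/2) ^ n < e"
      using real_arch_pow_inv[of e "1/2"] by auto
    have "eventually (\<lambda>x. x \<in> W n) (nhds 0)"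
      using W(1)[of n] by (simp add: good_def nbhds_neutral_def)
    then show "eventually (\<lambda>x. dist (\<rho> x) 0 < e) (nhds 0)"
    proof eventually_elim
      case (elim x)
      then have "\<rho> x < (1/2) ^ n" using \<delta>_less[of x n] \<rho>_le[OF \<delta>_in, of x] by simp
      with n \<rho>_nonneg[of x] show ?case by (simp add: dist_real_def)
    qed
  qed
  \<comment> \<open>\<open>chain\<close> at level \<open>0\<close> controls the points with
    \<open>\<rho> x < 1/2\<close>; doubling moves this threshold to \<open>1\<close>.\<close>
  show thesis
  proof (rule that[of "\<lambda>x. 2 * \<rho> x"])
    show "((\<lambda>x. 2 * \<rho> x) \<longlongrightarrow> 0) (nhds 0)"
      using tendsto_mult_left[OF lim, of 2] by simp
    show "2 * \<rho> (x + y) \<le> 2 * \<rho> x + 2 * \<rho> y" for x y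
      using \<rho>_add[of x y] by simp
  qed (use \<rho>_0 \<rho>_nonneg \<rho>_neg \<rho>_V in auto)
qed

section \<open>Minimax and almost invariant weights\<close>

text \<open>\<open>L\<close> is an arbitrary set; only the values of the functions on it have to be closed under convex
  combinations, since function types are not real vector spaces here.\<close>

lemma convexlike_two_functions:
  fixes F G :: "'l \<Rightarrow> real"
  assumes conv: "\<And>u v t. u \<in> L \<Longrightarrow> v \<in> L \<Longrightarrow> 0 \<le> t \<Longrightarrow> t \<le> 1 \<Longrightarrow>
      \<exists>w\<in>L. F w = (1 - t) * F u + t * F v \<and> G w = (1 - t) * G u + t * G v"
    and neg: "\<And>u. u \<in> L \<Longrightarrow> F u \<le> 0 \<or> G u \<le> 0"
  shows "\<exists>p. 0 \<le> p \<and> p \<le> 1 \<and> (\<forall>u\<in>L. p * F u + (1 - p) * G u \<le> 0)"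
proof (cases "L = {}")
  case False
  \<comment> \<open>The image of \<open>L\<close> in the plane is convex and misses the open
    positive quadrant; a separating normal vector, normalised to coordinate sum one, gives the
    weights \<open>p\<close> and \<open>1 - p\<close>.\<close>
  define S where "S = (\<lambda>u. (F u, G u)) ` L"
  define T where "T = {0::real<..} \<times> {0::real<..}"
  have "convex S"
    unfolding convex_alt
  proof (intro ballI allI impI)
    fix x y and t :: real assume xy: "x \<in> S" "y \<in> S" and t: "0 \<le> t \<and> t \<le> 1"
    then obtain u v where uv: "u \<in> L" "v \<in> L" "x = (F u, G u)" "y = (F v, G v)"
      by (auto simp: S_def)
    then obtain w where "w \<in> L" "F w = (1 - t) * F u + t * F v" "G w = (1 - t) * G u + t * G v"
      using conv[of u v t] t by blast
    then show "(1 - t) *\<^sub>R x + t *\<^sub>R y \<in> S"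
      unfolding S_def using uv by (intro image_eqI[of _ _ w]) simp_all
  qed
  moreover have "convex T" by (simp add: T_def convex_Times)
  moreover have "S \<noteq> {}" "T \<noteq> {}" using False by (auto simp: S_def T_def intro: exI[of _ 1])
  moreover have "S \<inter> T = {}" using neg by (force simp: S_def T_def)
  ultimately obtain c b where c: "c \<noteq> 0" "\<And>x. x \<in> S \<Longrightarrow> inner c x \<le> b" "\<And>x. x \<in> T \<Longrightarrow> b \<le> inner c x"
    using separating_hyperplane_sets[of S T] by blast
  obtain \<alpha> \<beta> where c_eq: "c = (\<alpha>, \<beta>)" by (cases c)
  have T: "b \<le> \<alpha> * x + \<beta> * y" if "x > 0" "y > 0" for x y
    using c(3)[of "(x, y)"] that by (simp add: T_def c_eq)
  have "\<alpha> \<ge> 0"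
  proof (rule ccontr)
    assume "\<not> \<alpha> \<ge> 0"
    then have "\<alpha> < 0" by simp
    \<comment> \<open>\<open>x\<close> is so large that \<open>\<alpha> * x\<close> outweighs
      \<open>\<beta>\<close> and \<open>b\<close>; as the quadrant is unbounded, a negative
      coordinate is impossible.\<close>
    define x where "x = (\<bar>\<beta>\<bar> + \<bar>b\<bar> + 1) / (- \<alpha>)"
    have "x > 0" using \<open>\<alpha> < 0\<close> unfolding x_def by (intro divide_pos_pos) auto
    moreover have "\<alpha> * x = - (\<bar>\<beta>\<bar> + \<bar>b\<bar> + 1)" using \<open>\<alpha> < 0\<close> by (simp add: x_def field_simps)
    ultimately show False using T[of x 1] by simp
  qed
  moreover have "\<beta> \<ge> 0"
  proof (rule ccontr)
    assume "\<not> \<beta> \<ge> 0"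
    then have "\<beta> < 0" by simp
    define x where "x = (\<bar>\<alpha>\<bar> + \<bar>b\<bar> + 1) / (- \<beta>)"
    have "x > 0" using \<open>\<beta> < 0\<close> unfolding x_def by (intro divide_pos_pos) auto
    moreover have "\<beta> * x = - (\<bar>\<alpha>\<bar> + \<bar>b\<bar> + 1)" using \<open>\<beta> < 0\<close> by (simp add: x_def field_simps)
    ultimately show False using T[of 1 x] by simp
  qed
  ultimately have pos: "\<alpha> + \<beta> > 0" "\<alpha> \<ge> 0" "\<beta> \<ge> 0"
    using c(1) by (auto simp: c_eq zero_prod_def)
  \<comment> \<open>Points of the quadrant tend to the origin, so the separating level
    \<open>b\<close> cannot be positive; the chosen point has value exactly
    \<open>e\<close>.\<close>
  have "b \<le> 0"
  proof (rule field_le_epsilon)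
    fix e :: real assume "e > 0"
    then have "b \<le> \<alpha> * (e / (\<alpha> + \<beta>)) + \<beta> * (e / (\<alpha> + \<beta>))"
      using pos by (intro T) auto
    also have "\<dots> = e" using pos by (simp add: add_divide_distrib[symmetric] distrib_right[symmetric])
    finally show "b \<le> 0 + e" by simp
  qed
  have "\<alpha> / (\<alpha> + \<beta>) * F u + (1 - \<alpha> / (\<alpha> + \<beta>)) * G u \<le> 0" if "u \<in> L" for u
  proof -
    have "\<alpha> * F u + \<beta> * G u \<le> 0"
      using c(2)[of "(F u, G u)"] that \<open>b \<le> 0\<close> by (simp add: S_def c_eq)
    moreover have "1 - \<alpha> / (\<alpha> + \<beta>) = \<beta> / (\<alpha> + \<beta>)" using pos by (simp add: field_simps)
    ultimately show ?thesis
      using pos by (simp add: add_divide_distrib[symmetric] divide_le_0_iff)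
  qed
  then show ?thesis
    using pos by (intro exI[of _ "\<alpha> / (\<alpha> + \<beta>)"]) simp
qed (auto intro: exI[of _ 0])

text \<open>Induction on \<open>I\<close>: on the part of \<open>L\<close> where \<open>f j\<close>
  is positive the other functions still satisfy the hypotheses, so some convex combination
  \<open>F\<close> of them is nonpositive there. Then at each point of \<open>L\<close> one of
  \<open>F\<close> and \<open>f j\<close> is nonpositive, and the case of two functions
  applies.\<close>

lemma convexlike_minimax:
  fixes f :: "'i \<Rightarrow> 'l \<Rightarrow> real"
  assumes "finite I" "I \<noteq> {}"
    and "\<And>u v t. u \<in> L \<Longrightarrow> v \<in> L \<Longrightarrow> 0 \<le> t \<Longrightarrow> t \<le> 1 \<Longrightarrow>
      \<exists>w\<in>L. \<forall>i\<in>I. f i w = (1 - t) * f i u + t * f i v"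
    and "\<And>u. u \<in> L \<Longrightarrow> \<exists>i\<in>I. f i u \<le> 0"
  shows "\<exists>p. (\<forall>i\<in>I. 0 \<le> p i) \<and> sum p I = 1 \<and> (\<forall>u\<in>L. (\<Sum>i\<in>I. p i * f i u) \<le> 0)"
  using assms
proof (induction I arbitrary: L rule: finite_ne_induct)
  case (singleton i)
  then show ?case by (intro exI[of _ "\<lambda>_. 1"]) simp
next
  case (insert j I)
  note conv = insert.prems(1)
  define L' where "L' = {u \<in> L. 0 < f j u}"
  have conv': "\<exists>w\<in>L'. \<forall>i\<in>I. f i w = (1 - t) * f i u + t * f i v"
    if that': "u \<in> L'" "v \<in> L'" "0 \<le> t" "t \<le> 1" for u v t
  proof -
    have "u \<in> L" "v \<in> L" using that by (simp_all add: L'_def)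
    then obtain w where w: "w \<in> L" "\<forall>i\<in>insert j I. f i w = (1 - t) * f i u + t * f i v"
      using conv[OF _ _ that'(3,4)] by blast
    have "0 < (1 - t) * f j u + t * f j v"
    proof (cases "t = 0")
      case False
      then show ?thesis using that by (intro add_nonneg_pos) (auto simp: L'_def)
    qed (use that in \<open>simp add: L'_def\<close>)
    with w show ?thesis by (intro bexI[of _ w]) (auto simp: L'_def)
  qed
  have "\<exists>i\<in>I. f i u \<le> 0" if "u \<in> L'" for u
    using insert.prems(2)[of u] that by (auto simp: L'_def)
  then obtain p where p: "\<forall>i\<in>I. 0 \<le> p i" "sum p I = 1" "\<And>u. u \<in> L' \<Longrightarrow> (\<Sum>i\<in>I. p i * f i u) \<le> 0"
    using insert.IH[of L'] conv' by blast
  define F where "F u = (\<Sum>i\<in>I. p i * f i u)" for u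
  have "\<exists>w\<in>L. F w = (1 - t) * F u + t * F v \<and> f j w = (1 - t) * f j u + t * f j v"
    if that': "u \<in> L" "v \<in> L" "0 \<le> t" "t \<le> 1" for u v t
  proof -
    obtain w where w: "w \<in> L" "\<forall>i\<in>insert j I. f i w = (1 - t) * f i u + t * f i v"
      using conv[OF that'] by blast
    have "F w = (\<Sum>i\<in>I. (1 - t) * (p i * f i u) + t * (p i * f i v))"
      unfolding F_def
    proof (rule sum.cong[OF refl])
      fix i assume "i \<in> I"
      with w(2) have "f i w = (1 - t) * f i u + t * f i v" by blast
      then show "p i * f i w = (1 - t) * (p i * f i u) + t * (p i * f i v)"
        by (simp only:) (simp add: algebra_simps)
    qed
    then have "F w = (1 - t) * F u + t * F v"
      by (simp add: F_def sum.distrib sum_distrib_left)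
    with w show ?thesis by blast
  qed
  moreover have "F u \<le> 0 \<or> f j u \<le> 0" if "u \<in> L" for u
    using p(3)[of u] that by (cases "0 < f j u") (auto simp: L'_def F_def)
  ultimately obtain q where q: "0 \<le> q" "q \<le> 1" "\<And>u. u \<in> L \<Longrightarrow> q * F u + (1 - q) * f j u \<le> 0"
    using convexlike_two_functions[of L F "f j"] by blast
  define p' where "p' i = (if i = j then 1 - q else q * p i)" for i
  have p': "p' i = q * p i" if "i \<in> I" for i
    using that insert.hyps by (auto simp: p'_def)
  have "(\<Sum>i\<in>insert j I. p' i * f i u) = q * F u + (1 - q) * f j u" for u
    using insert.hyps by (simp add: p' F_def sum_distrib_left mult.assoc) (simp add: p'_def)
  moreover have "sum p' (insert j I) = 1"
    using insert.hyps p(2) by (simp add: p' sum_distrib_left[symmetric]) (simp add: p'_def)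
  moreover have "\<forall>i\<in>insert j I. 0 \<le> p' i"
    using p(1) q by (auto simp: p'_def)
  ultimately show ?case using q(3) by (intro exI[of _ p']) simp
qed

section \<open>Finitely supported almost invariant weights\<close>

lemma is_mean_sum:
  assumes m: "is_mean X F \<mu>" and one: "(\<lambda>_. 1) \<in> F"
    and add: "\<And>f g. f \<in> F \<Longrightarrow> g \<in> F \<Longrightarrow> (\<lambda>x. f x + g x) \<in> F"
    and scale: "\<And>c f. f \<in> F \<Longrightarrow> (\<lambda>x. c * f x) \<in> F"
    and "finite E" "\<And>i. i \<in> E \<Longrightarrow> f i \<in> F"
  shows "(\<lambda>x. \<Sum>i\<in>E. f i x) \<in> F \<and> \<mu> (\<lambda>x. \<Sum>i\<in>E. f i x) = (\<Sum>i\<in>E. \<mu> (f i))"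
  using assms(5,6)
proof (induction E rule: finite_induct)
  case empty
  show ?case using scale[OF one, of 0] is_mean_scale[OF m one, of 0] by simp
next
  case (insert i E)
  then show ?case using add[of "f i" "\<lambda>x. \<Sum>i\<in>E. f i x"] is_mean_add[OF m, of "f i" "\<lambda>x. \<Sum>i\<in>E. f i x"]
    by simp
qed

text \<open>For each family \<open>h\<close> of test functions the total displacement
  \<open>f x h\<close> has invariant mean zero in \<open>x\<close>, hence is below
  \<open>\<epsilon>\<close> somewhere. Compactness and minimax turn this into a single weight
  \<open>p\<close> on a finite set that works for all families. Testing with a truncated distance
  function, equal to \<open>1\<close> on \<open>g + S\<close> and vanishing outside its
  \<open>V\<close>-neighbourhood, gives the Hall-type inequality.\<close>

lemma amenable_finite_weights:
  fixes V :: "'a::topological_group_add set"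
  assumes am: "amenable_topological_group TYPE('a)" and V: "V \<in> nbhds_neutral"
    and E: "finite E" and \<epsilon>: "0 < (\<epsilon>::real)"
  obtains X p where "finite X" "\<And>x. x \<in> X \<Longrightarrow> 0 \<le> p x" "sum p X = 1"
    "\<And>S g. S \<subseteq> X \<Longrightarrow> g \<in> E \<Longrightarrow> sum p S \<le> sum p {y\<in>X. \<exists>s\<in>S. y - (g + s) \<in> V} + \<epsilon>"
proof -
  obtain \<omega> :: "'a \<Rightarrow> real" where \<omega>: "\<omega> 0 = 0" "\<And>x. 0 \<le> \<omega> x" "\<And>x. \<omega> (- x) = \<omega> x"
    "\<And>x y. \<omega> (x + y) \<le> \<omega> x + \<omega> y" "(\<omega> \<longlongrightarrow> 0) (nhds 0)" "\<And>x. \<omega> x < 1 \<Longrightarrow> x \<in> V"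
    using nbhds_neutral_pseudonorm[OF V] by blast
  obtain M where M: "is_mean UNIV (RUC_b :: ('a \<Rightarrow> real) set) M"
      "\<And>f g. f \<in> RUC_b \<Longrightarrow> M (f \<circ> (\<lambda>x. g + x)) = M f"
    using am unfolding amenable_topological_group_def by blast
  \<comment> \<open>The functions that are 1-Lipschitz for the right-invariant pseudometric
    \<open>\<omega> (x - y)\<close>. Having a common modulus, the condition passes to pointwise
    limits and convex combinations.\<close>
  define H where "H = {h :: 'a \<Rightarrow> real. (\<forall>x. 0 \<le> h x \<and> h x \<le> 1) \<and> (\<forall>w z. \<bar>h (w + z) - h z\<bar> \<le> \<omega> w)}"
  define L where "L = {h :: 'a \<Rightarrow> 'a \<Rightarrow> real. \<forall>g. h g \<in> H}"
  define f where "f x h = (\<Sum>g\<in>E. h g (g + x) - h g x)" for x :: 'a and h :: "'a \<Rightarrow> 'a \<Rightarrow> real"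
  have H_RUC: "h \<in> RUC_b" if "h \<in> H" for h
    unfolding RUC_b_iff
  proof (intro conjI allI impI)
    show "bounded (range h)" using that by (auto simp: H_def bounded_iff intro!: exI[of _ 1])
    fix e :: real assume "e > 0"
    then have "eventually (\<lambda>x. \<omega> x < e) (nhds 0)" by (rule order_tendstoD(2)[OF \<omega>(5)])
    moreover have "\<bar>h x - h y\<bar> \<le> \<omega> (x - y)" for x y
      using that unfolding H_def by (metis (mono_tags, lifting) diff_add_cancel mem_Collect_eq)
    ultimately show "\<exists>U\<in>nbhds_neutral. \<forall>x y. x - y \<in> U \<longrightarrow> \<bar>h x - h y\<bar> < e"
      by (intro bexI[of _ "{x. \<omega> x < e}"]) (auto simp: nbhds_neutral_def intro: le_less_trans)
  qed
  have small: "\<exists>x. f x h < \<epsilon>" if h: "h \<in> L" for h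
  proof (rule ccontr)
    assume "\<nexists>x. f x h < \<epsilon>"
    then have ge: "\<epsilon> \<le> f x h" for x by (simp add: not_less)
    \<comment> \<open>\<open>k g\<close> is the negative of the displacement, so that the upper
      bound from \<open>is_mean_bound\<close> contradicts mean zero.\<close>
    define k where "k g x = (-1) * (h g \<circ> (\<lambda>x. g + x)) x + h g x" for g x
    have hg: "h g \<in> RUC_b" for g using h by (auto simp: L_def H_RUC)
    note tr = RUC_b_translate[OF hg]
    have k: "k g \<in> RUC_b" "M (k g) = 0" for g
    proof -
      show "k g \<in> RUC_b" unfolding k_def[abs_def] by (intro RUC_b_add RUC_b_scale tr hg)
      show "M (k g) = 0"
        unfolding k_def[abs_def]
        using is_mean_add[OF M(1) RUC_b_scale[OF tr] hg, of "-1" g g g]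
          is_mean_scale[OF M(1) tr, of "-1" g g] M(2)[OF hg, of g g] by simp
    qed
    have sum: "(\<lambda>x. \<Sum>g\<in>E. k g x) \<in> RUC_b \<and> M (\<lambda>x. \<Sum>g\<in>E. k g x) = (\<Sum>g\<in>E. M (k g))"
      by (rule is_mean_sum[OF M(1) RUC_b_const RUC_b_add RUC_b_scale E k(1)])
    have "M (\<lambda>x. \<Sum>g\<in>E. k g x) \<le> - \<epsilon>"
    proof (rule is_mean_bound[OF M(1) _ RUC_b_const RUC_b_add RUC_b_scale])
      fix x
      have "(\<Sum>g\<in>E. k g x) = - f x h"
        unfolding f_def sum_negf[symmetric] by (intro sum.cong) (simp_all add: k_def)
      then show "(\<Sum>g\<in>E. k g x) \<le> - \<epsilon>" using ge[of x] by simp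
    qed (use sum in simp)
    with sum k(2) \<epsilon> show False by simp
  qed
  \<comment> \<open>Compactness of \<open>L\<close> under pointwise convergence reduces the test points to finitely many.\<close>
  have "\<exists>X. finite X \<and> X \<noteq> {} \<and> (\<forall>h\<in>L. \<exists>x\<in>X. f x h - \<epsilon> \<le> 0)"
  proof (rule ccontr)
    assume "\<not> ?thesis"
    \<comment> \<open>Inserting \<open>0\<close> takes care of the requirement
      \<open>X \<noteq> {}\<close>.\<close>
    then have "\<exists>h\<in>L. \<forall>x\<in>X. \<epsilon> < f x h" if "finite X" for X
      using that by (auto dest!: spec[of _ "insert 0 X"] simp: not_le)
    then obtain h where h: "\<And>X. finite X \<Longrightarrow> h X \<in> L" "\<And>X x. finite X \<Longrightarrow> x \<in> X \<Longrightarrow> \<epsilon> < f x (h X)"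
      by metis
    \<comment> \<open>A family of functions is read as one function of pairs, with value
      \<open>0\<close> for infinite \<open>X\<close> so that the bound holds for all
      \<open>X\<close>.\<close>
    define m where "m X = (\<lambda>(g, x). if finite X then h X g x else 0)" for X
    have "\<bar>m X gx\<bar> \<le> 1" for X gx
      using h(1)[of X] by (auto simp: m_def L_def H_def case_prod_unfold abs_le_iff)
    then obtain \<Psi> l where \<Psi>: "\<Psi> \<le> finite_sets_at_top" "\<Psi> \<noteq> bot"
        and l: "\<And>gx. ((\<lambda>X. m X gx) \<longlongrightarrow> l gx) \<Psi>"
      using bounded_family_convergent_refinement[of m "\<lambda>_. 1" finite_sets_at_top]
        finite_subsets_at_top_neq_bot by blast
    have ev: "eventually (\<lambda>X. finite X \<and> x \<in> X) \<Psi>" for x :: 'a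
      using \<Psi>(1) by (rule filter_leD)
        (auto simp: eventually_finite_subsets_at_top intro!: exI[of _ "{x}"])
    define k where "k g x = l (g, x)" for g x
    have lim: "((\<lambda>X. h X g x) \<longlongrightarrow> k g x) \<Psi>" for g x
      unfolding k_def
      by (rule Lim_transform_eventually[OF l]) (use ev[of 0] in \<open>eventually_elim, simp add: m_def\<close>)
    have hH: "eventually (\<lambda>X. h X g \<in> H) \<Psi>" for g
      using ev[of 0] by eventually_elim (use h(1) in \<open>simp add: L_def\<close>)
    have "k g \<in> H" for g
      unfolding H_def
    proof (intro CollectI conjI allI)
      fix x w z
      show "0 \<le> k g x"
        by (rule tendsto_lowerbound[OF lim _ \<Psi>(2)]) (use hH[of g] in \<open>eventually_elim, simp add: H_def\<close>)
      show "k g x \<le> 1"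
        by (rule tendsto_upperbound[OF lim _ \<Psi>(2)]) (use hH[of g] in \<open>eventually_elim, simp add: H_def\<close>)
      show "\<bar>k g (w + z) - k g z\<bar> \<le> \<omega> w"
        by (rule tendsto_upperbound[OF tendsto_rabs[OF tendsto_diff[OF lim lim]] _ \<Psi>(2)])
           (use hH[of g] in \<open>eventually_elim, simp add: H_def\<close>)
    qed
    then have "k \<in> L" by (simp add: L_def)
    then obtain x where x: "f x k < \<epsilon>" using small by blast
    \<comment> \<open>\<open>f x\<close> involves only finitely many values of its argument, hence
      is continuous for pointwise convergence.\<close>
    have "\<epsilon> \<le> f x k"
    proof (rule tendsto_lowerbound[OF _ _ \<Psi>(2)])
      show "((\<lambda>X. f x (h X)) \<longlongrightarrow> f x k) \<Psi>"
        unfolding f_def by (intro tendsto_sum tendsto_diff lim)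
      show "eventually (\<lambda>X. \<epsilon> \<le> f x (h X)) \<Psi>"
        using ev[of x] by eventually_elim (use h(2) in \<open>auto intro: less_imp_le\<close>)
    qed
    with x show False by simp
  qed
  then obtain X where X: "finite X" "X \<noteq> {}" "\<And>h. h \<in> L \<Longrightarrow> \<exists>x\<in>X. f x h - \<epsilon> \<le> 0" by blast
  have "\<exists>w\<in>L. \<forall>x\<in>X. f x w - \<epsilon> = (1 - t) * (f x u - \<epsilon>) + t * (f x v - \<epsilon>)"
    if uv: "u \<in> L" "v \<in> L" and t: "0 \<le> t" "t \<le> 1" for u v t
  proof (intro bexI[of _ "\<lambda>g x. (1 - t) * u g x + t * v g x"] ballI)
    fix x
    have "f x (\<lambda>g x. (1 - t) * u g x + t * v g x) = (1 - t) * f x u + t * f x v"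
      unfolding f_def sum_distrib_left sum.distrib[symmetric]
      by (intro sum.cong) (simp_all add: algebra_simps)
    then show "f x (\<lambda>g x. (1 - t) * u g x + t * v g x) - \<epsilon> = (1 - t) * (f x u - \<epsilon>) + t * (f x v - \<epsilon>)"
      by (simp add: algebra_simps)
  next
    have "(\<lambda>x. (1 - t) * u g x + t * v g x) \<in> H" for g
      unfolding H_def
    proof (intro CollectI conjI allI)
      fix x w z
      have u: "0 \<le> u g x" "u g x \<le> 1" "\<bar>u g (w + z) - u g z\<bar> \<le> \<omega> w"
        and v: "0 \<le> v g x" "v g x \<le> 1" "\<bar>v g (w + z) - v g z\<bar> \<le> \<omega> w"
        using uv by (auto simp: L_def H_def)
      show "0 \<le> (1 - t) * u g x + t * v g x" using u v t by simp
      show "(1 - t) * u g x + t * v g x \<le> 1"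
        by (rule convex_bound_le) (use u v t in auto)
      have "\<bar>(1 - t) * u g (w + z) + t * v g (w + z) - ((1 - t) * u g z + t * v g z)\<bar>
          = \<bar>(1 - t) * (u g (w + z) - u g z) + t * (v g (w + z) - v g z)\<bar>"
        by (simp add: algebra_simps)
      also have "\<dots> \<le> (1 - t) * \<bar>u g (w + z) - u g z\<bar> + t * \<bar>v g (w + z) - v g z\<bar>"
        using t abs_triangle_ineq[of "(1 - t) * (u g (w + z) - u g z)" "t * (v g (w + z) - v g z)"]
        by (simp add: abs_mult)
      also have "\<dots> \<le> \<omega> w"
        by (rule convex_bound_le) (use u v t in auto)
      finally show "\<bar>(1 - t) * u g (w + z) + t * v g (w + z) - ((1 - t) * u g z + t * v g z)\<bar> \<le> \<omega> w" .
    qed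
    then show "(\<lambda>g x. (1 - t) * u g x + t * v g x) \<in> L" by (simp add: L_def)
  qed
  then obtain p where p: "\<And>x. x \<in> X \<Longrightarrow> 0 \<le> p x" "sum p X = 1"
      "\<And>h. h \<in> L \<Longrightarrow> (\<Sum>x\<in>X. p x * (f x h - \<epsilon>)) \<le> 0"
    using convexlike_minimax[of X L "\<lambda>x h. f x h - \<epsilon>"] X by blast
  have "sum p S \<le> sum p {y\<in>X. \<exists>s\<in>S. y - (g + s) \<in> V} + \<epsilon>" if S: "S \<subseteq> X" and g: "g \<in> E" for S g
  proof (cases "S = {}")
    case False
    have finS: "finite S" using S X(1) finite_subset by blast
    \<comment> \<open>\<open>r z\<close> is the pseudometric distance from \<open>z\<close> to
      \<open>g + S\<close>, attained because \<open>S\<close> is finite and nonempty here. It is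
      1-Lipschitz, and so is its truncation \<open>h\<close> below, the test function.\<close>
    define r where "r z = Min ((\<lambda>s. \<omega> (z - (g + s))) ` S)" for z
    have r_le: "r z \<le> \<omega> (z - (g + s))" if "s \<in> S" for z s
      unfolding r_def using finS that by (intro Min_le) auto
    have r_attained: "\<exists>s\<in>S. r z = \<omega> (z - (g + s))" for z
    proof -
      have "r z \<in> (\<lambda>s. \<omega> (z - (g + s))) ` S"
        unfolding r_def using finS False by (intro Min_in) auto
      then show ?thesis by auto
    qed
    have r_add: "r (w + z) \<le> \<omega> w + r z" for w z
    proof -
      obtain s where s: "s \<in> S" "r z = \<omega> (z - (g + s))" using r_attained by blast
      have "r (w + z) \<le> \<omega> (w + (z - (g + s)))" using r_le[OF s(1), of "w + z"] by (simp only: add_diff_eq)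
      also have "\<dots> \<le> \<omega> w + r z" using \<omega>(4) s(2) by simp
      finally show ?thesis .
    qed
    have r_lip: "\<bar>r (w + z) - r z\<bar> \<le> \<omega> w" for w z
      using r_add[of w z] r_add[of "- w" "w + z"] \<omega>(3)[of w] by (simp add: add.assoc[symmetric] abs_le_iff)
    have r_nonneg: "0 \<le> r z" for z using r_attained[of z] \<omega>(2) by auto
    define h where "h z = max 0 (1 - r z)" for z
    have "h \<in> H"
      unfolding H_def
    proof (intro CollectI conjI allI)
      fix x w z
      show "0 \<le> h x" "h x \<le> 1" using r_nonneg by (simp_all add: h_def)
      show "\<bar>h (w + z) - h z\<bar> \<le> \<omega> w" using r_lip[of w z] unfolding h_def by linarith
    qed
    moreover have "(\<lambda>_. 0) \<in> H" using \<omega>(2) by (simp add: H_def)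
    \<comment> \<open>All indices other than \<open>g\<close> carry the zero function, which removes
      their terms from \<open>f\<close>.\<close>
    ultimately have hL: "(\<lambda>g'. if g' = g then h else (\<lambda>_. 0)) \<in> L"
      by (simp add: L_def)
    have "f x (\<lambda>g'. if g' = g then h else (\<lambda>_. 0)) = h (g + x) - h x" for x
    proof -
      have "f x (\<lambda>g'. if g' = g then h else (\<lambda>_. 0)) = (\<Sum>g'\<in>E. if g' = g then h (g + x) - h x else 0)"
        unfolding f_def by (intro sum.cong) auto
      then show ?thesis using E g by simp
    qed
    then have "(\<Sum>x\<in>X. p x * (h (g + x) - h x - \<epsilon>)) \<le> 0"
      using p(3)[OF hL] by simp
    then have "(\<Sum>x\<in>X. p x * h (g + x)) \<le> (\<Sum>x\<in>X. p x * h x) + \<epsilon>"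
      using p(2) by (simp add: right_diff_distrib sum_subtractf sum_distrib_right[symmetric])
    moreover have "sum p S \<le> (\<Sum>x\<in>X. p x * h (g + x))"
    proof -
      have "r (g + s) = 0" if "s \<in> S" for s
        using r_le[OF that, of "g + s"] r_nonneg[of "g + s"] \<omega>(1) by simp
      then have "sum p S = (\<Sum>x\<in>S. p x * h (g + x))"
        by (intro sum.cong) (simp_all add: h_def)
      also have "\<dots> \<le> (\<Sum>x\<in>X. p x * h (g + x))"
        using S X(1) p(1) by (intro sum_mono2) (auto simp: h_def)
      finally show ?thesis .
    qed
    moreover have "(\<Sum>x\<in>X. p x * h x) \<le> sum p {y\<in>X. \<exists>s\<in>S. y - (g + s) \<in> V}"
    proof -
      have "h x = 0" if "x \<in> X - {y\<in>X. \<exists>s\<in>S. y - (g + s) \<in> V}" for x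
        using r_attained[of x] that \<omega>(6) by (force simp: h_def not_less)
      then have "(\<Sum>x\<in>X. p x * h x) = (\<Sum>x\<in>{y\<in>X. \<exists>s\<in>S. y - (g + s) \<in> V}. p x * h x)"
        using X(1) by (intro sum.mono_neutral_right) auto
      also have "\<dots> \<le> sum p {y\<in>X. \<exists>s\<in>S. y - (g + s) \<in> V}"
        using p(1) r_nonneg by (intro sum_mono mult_left_le) (auto simp: h_def)
      finally show ?thesis .
    qed
    ultimately show ?thesis by simp
  qed (use \<epsilon> in simp)
  with X(1) p(1,2) show thesis using that by blast
qed

section \<open>Matchings and finite sets\<close>

text \<open>Induction on the size of \<open>S\<close>. A nonempty proper subset \<open>T\<close>
  without surplus is matched first, and the rest is matched with partners outside those of
  \<open>T\<close>, where Hall's condition follows from the one for \<open>T \<union> T'\<close>. If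
  every nonempty proper subset has a surplus, an arbitrary partner of one element can be
  spent.\<close>

lemma hall_marriage:
  fixes N :: "'a \<Rightarrow> 'b set"
  assumes "finite S" "\<And>s. s \<in> S \<Longrightarrow> finite (N s)"
    and "\<And>T. T \<subseteq> S \<Longrightarrow> card T \<le> card (\<Union>(N ` T))"
  shows "\<exists>\<phi>. inj_on \<phi> S \<and> (\<forall>s\<in>S. \<phi> s \<in> N s)"
  using assms
proof (induction "card S" arbitrary: S N rule: less_induct)
  case less
  note fin = less.prems(1,2) and hall = less.prems(3)
  have finU: "finite (\<Union>(N ` T))" if "T \<subseteq> S" for T
    using that fin by (meson finite_UN finite_subset subsetD)
  show ?case
  proof (cases "\<exists>T. T \<noteq> {} \<and> T \<subset> S \<and> card (\<Union>(N ` T)) \<le> card T")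
    case True
    then obtain T where T: "T \<noteq> {}" "T \<subset> S" "card (\<Union>(N ` T)) \<le> card T" by blast
    let ?M = "\<Union>(N ` T)"
    have finT: "finite T" using T(2) fin(1) finite_subset by blast
    have "card T < card S" using T(2) fin(1) psubset_card_mono by blast
    then obtain \<phi> where \<phi>: "inj_on \<phi> T" "\<And>s. s \<in> T \<Longrightarrow> \<phi> s \<in> N s"
      using less.hyps[of T N] finT fin(2) hall T(2) by (meson psubsetE subset_trans subsetD)
    have "card (S - T) < card S"
      using T(1,2) fin(1) by (intro psubset_card_mono) auto
    moreover have "card T' \<le> card (\<Union>s\<in>T'. N s - ?M)" if T': "T' \<subseteq> S - T" for T'
    proof -
      have "finite T'" using T' fin(1) finite_subset by blast
      have "card T + card T' = card (T \<union> T')"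
        using finT \<open>finite T'\<close> T' by (intro card_Un_disjoint[symmetric]) auto
      also have "\<dots> \<le> card (\<Union>(N ` (T \<union> T')))"
        using T' T(2) by (intro hall) auto
      also have "\<Union>(N ` (T \<union> T')) = ?M \<union> (\<Union>s\<in>T'. N s - ?M)" by auto
      also have "card \<dots> \<le> card ?M + card (\<Union>s\<in>T'. N s - ?M)" by (rule card_Un_le)
      finally show ?thesis using T(3) by simp
    qed
    ultimately obtain \<psi> where \<psi>: "inj_on \<psi> (S - T)" "\<And>s. s \<in> S - T \<Longrightarrow> \<psi> s \<in> N s - ?M"
      using less.hyps[of "S - T" "\<lambda>s. N s - ?M"] fin by fastforce
    let ?\<chi> = "\<lambda>s. if s \<in> T then \<phi> s else \<psi> s"
    have "inj_on ?\<chi> S"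
    proof (rule inj_onI)
      fix x y assume xy: "x \<in> S" "y \<in> S" "?\<chi> x = ?\<chi> y"
      have *: "\<phi> s \<noteq> \<psi> t" if "s \<in> T" "t \<in> S - T" for s t
        using \<phi>(2)[OF that(1)] \<psi>(2)[OF that(2)] that(1) by auto
      show "x = y"
      proof (cases "x \<in> T"; cases "y \<in> T")
        assume "x \<in> T" "y \<in> T"
        then show ?thesis using xy(3) inj_onD[OF \<phi>(1)] by simp
      next
        assume "x \<notin> T" "y \<notin> T"
        then show ?thesis using xy inj_onD[OF \<psi>(1)] by simp
      next
        assume "x \<in> T" "y \<notin> T"
        then show ?thesis using xy *[of x y] by simp
      next
        assume "x \<notin> T" "y \<in> T"
        then show ?thesis using xy *[of y x] by simp
      qed
    qed
    moreover have "\<forall>s\<in>S. ?\<chi> s \<in> N s" using \<phi>(2) \<psi>(2) by auto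
    ultimately show ?thesis by blast
  next
    case False
    show ?thesis
    proof (cases "S = {}")
      case False
      then obtain s where s: "s \<in> S" by blast
      have "card {s} \<le> card (\<Union>(N ` {s}))" using s by (intro hall) auto
      then obtain y where y: "y \<in> N s" by fastforce
      have "card (S - {s}) < card S" by (rule card_Diff1_less[OF fin(1) s])
      moreover have "card T \<le> card (\<Union>t\<in>T. N t - {y})" if T: "T \<subseteq> S - {s}" for T
      proof (cases "T = {}")
        case nonempty: False
        then have "card T < card (\<Union>(N ` T))"
          using T s \<open>\<nexists>T. T \<noteq> {} \<and> T \<subset> S \<and> card (\<Union>(N ` T)) \<le> card T\<close> by (auto simp: not_le)
        moreover have "card (\<Union>(N ` T) - {y}) \<ge> card (\<Union>(N ` T)) - 1"
          using finU[of T] T by (simp add: card_Diff_singleton_if)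
        moreover have "(\<Union>t\<in>T. N t - {y}) = \<Union>(N ` T) - {y}" by auto
        ultimately show ?thesis by simp
      qed simp
      ultimately obtain \<phi> where \<phi>: "inj_on \<phi> (S - {s})" "\<And>t. t \<in> S - {s} \<Longrightarrow> \<phi> t \<in> N t - {y}"
        using less.hyps[of "S - {s}" "\<lambda>t. N t - {y}"] fin by fastforce
      have "inj_on (\<phi>(s := y)) S"
        using \<phi> by (auto simp: inj_on_def)
      moreover have "\<forall>t\<in>S. (\<phi>(s := y)) t \<in> N t" using \<phi>(2) y by auto
      ultimately show ?thesis by blast
    qed simp
  qed
qed

lemma hall_marriage_deficiency:
  fixes N :: "'a \<Rightarrow> 'b set"
  assumes "finite S" and finN: "\<And>s. s \<in> S \<Longrightarrow> finite (N s)"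
    and hall: "\<And>T. T \<subseteq> S \<Longrightarrow> card T \<le> card (\<Union>(N ` T)) + d"
  obtains A \<phi> where "A \<subseteq> S" "card (S - A) \<le> d" "inj_on \<phi> A" "\<forall>s\<in>A. \<phi> s \<in> N s"
proof -
  \<comment> \<open>Adding \<open>d\<close> dummy partners available to everybody restores Hall's condition.\<close>
  define N' where "N' s = Inl ` N s \<union> (Inr ` {..<d} :: ('b + nat) set)" for s
  have "card T \<le> card (\<Union>(N' ` T))" if T: "T \<subseteq> S" for T
  proof (cases "T = {}")
    case False
    then have eq: "\<Union>(N' ` T) = Inl ` \<Union>(N ` T) \<union> Inr ` {..<d}" by (auto simp: N'_def)
    have "finite (\<Union>(N ` T))"
      using T assms(1) finN by (meson finite_UN finite_subset subsetD)
    then have "card (\<Union>(N' ` T)) = card (\<Union>(N ` T)) + d"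
      unfolding eq by (subst card_Un_disjoint) (auto simp: card_image)
    then show ?thesis using hall[OF T] by simp
  qed simp
  then obtain \<psi> where \<psi>: "inj_on \<psi> S" "\<And>s. s \<in> S \<Longrightarrow> \<psi> s \<in> N' s"
    using hall_marriage[of S N'] assms(1) finN by (auto simp: N'_def)
  \<comment> \<open>Elements matched with dummies are discarded; injectivity of
    \<open>\<psi>\<close> bounds their number by \<open>d\<close>.\<close>
  define A where "A = {s \<in> S. isl (\<psi> s)}"
  have "card (S - A) \<le> card (Inr ` {..<d} :: ('b + nat) set)"
  proof (rule card_inj_on_le)
    show "inj_on \<psi> (S - A)" using \<psi>(1) by (rule inj_on_subset) auto
    show "\<psi> ` (S - A) \<subseteq> Inr ` {..<d}" using \<psi>(2) by (fastforce simp: A_def N'_def)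
  qed simp
  then have "card (S - A) \<le> d" by (simp add: card_image)
  moreover have "inj_on (\<lambda>s. projl (\<psi> s)) A"
    using \<psi>(1) unfolding A_def inj_on_def by (metis (mono_tags, lifting) mem_Collect_eq sum.collapse(1))
  moreover have "projl (\<psi> s) \<in> N s" if "s \<in> A" for s
    using that \<psi>(2)[of s] by (auto simp: A_def N'_def)
  ultimately show thesis using that[of A "\<lambda>s. projl (\<psi> s)"] by (auto simp: A_def)
qed

section \<open>From weights to finite sets in general position\<close>

lemma infinite_nbhds_neutral:
  fixes U :: "'a::{topological_group_add, t2_space} set"
  assumes "{0} \<notin> (nbhds_neutral :: 'a set set)" "U \<in> nbhds_neutral"
  shows "infinite U"
proof
  assume "finite U"
  \<comment> \<open>Since points are closed, a finite neighbourhood can be shrunk to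
    \<open>{0}\<close> by removing its other points.\<close>
  have "eventually (\<lambda>y. \<forall>x\<in>U - {0}. y \<noteq> x) (nhds (0::'a))"
    using \<open>finite U\<close> by (intro eventually_ball_finite) (auto intro: t1_space_nhds)
  moreover have "eventually (\<lambda>y. y \<in> U) (nhds 0)"
    using assms(2) by (simp add: nbhds_neutral_def)
  ultimately have "eventually (\<lambda>y. y \<in> {0::'a}) (nhds 0)"
    by eventually_elim auto
  with assms(1) show False by (simp add: nbhds_neutral_def)
qed

text \<open>Greedy choice: only finitely many points conflict with those chosen before, and symmetry
  of the relation covers both orders of a pair.\<close>

lemma generic_choice:
  assumes "finite I" "\<And>a. a \<in> I \<Longrightarrow> infinite (Q a)" "\<And>y. finite (R y)"
    and sym: "\<And>x y. y \<in> R x \<Longrightarrow> x \<in> R y"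
  shows "\<exists>c. (\<forall>a\<in>I. c a \<in> Q a) \<and> (\<forall>a\<in>I. \<forall>b\<in>I. a \<noteq> b \<longrightarrow> c a \<notin> R (c b))"
  using assms(1,2)
proof (induction I rule: finite_induct)
  case (insert a I)
  then obtain c where c: "\<forall>a\<in>I. c a \<in> Q a" "\<forall>a\<in>I. \<forall>b\<in>I. a \<noteq> b \<longrightarrow> c a \<notin> R (c b)" by auto
  have "infinite (Q a - (\<Union>b\<in>I. R (c b)))"
    using insert assms(3) by (intro Diff_infinite_finite) auto
  then have "Q a - (\<Union>b\<in>I. R (c b)) \<noteq> {}"
    by (metis finite.emptyI)
  then obtain y where y: "y \<in> Q a" "\<And>b. b \<in> I \<Longrightarrow> y \<notin> R (c b)" by blast
  show ?case
  proof (intro exI conjI ballI impI)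
    fix b assume "b \<in> insert a I"
    then show "(c(a := y)) b \<in> Q b" using c(1) y(1) by auto
    fix b' assume "b' \<in> insert a I" "b \<noteq> b'"
    with \<open>b \<in> insert a I\<close> show "(c(a := y)) b \<notin> R ((c(a := y)) b')"
      using c(2) y(2) insert.hyps(2) sym[of "c b" y] by auto
  qed
qed simp

text \<open>Weights become multiplicities \<open>k x\<close>, about \<open>N * p x\<close>, and the
  \<open>k x\<close> copies of \<open>x\<close> become distinct points of \<open>W + x\<close>. The
  rounding and the slack in \<open>amenable_finite_weights\<close> each cost at most
  \<open>N * \<delta>\<close>, and moving points within \<open>W\<close> only enlarges
  \<open>V\<close> to \<open>U\<close>.\<close>

lemma amenable_finite_sets:
  fixes U :: "'a::{topological_group_add, t2_space} set"
  assumes am: "amenable_topological_group TYPE('a)" and nd: "{0} \<notin> (nbhds_neutral :: 'a set set)"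
    and U: "U \<in> nbhds_neutral" and E: "finite E" and \<epsilon>: "0 < (\<epsilon>::real)"
  obtains F where "finite F" "F \<noteq> {}"
    "\<And>g s t. g \<in> E \<Longrightarrow> g \<noteq> 0 \<Longrightarrow> s \<in> F \<Longrightarrow> t \<in> F \<Longrightarrow> t \<noteq> g + s"
    "\<And>S g. S \<subseteq> F \<Longrightarrow> g \<in> E \<Longrightarrow>
      real (card S) \<le> real (card {y\<in>F. \<exists>s\<in>S. y - (g + s) \<in> U}) + \<epsilon> * real (card F)"
proof -
  obtain V where V: "V \<in> nbhds_neutral" "\<And>x. x \<in> V \<Longrightarrow> - x \<in> V"
      "\<And>x y z. x \<in> V \<Longrightarrow> y \<in> V \<Longrightarrow> z \<in> V \<Longrightarrow> x + y + z \<in> U"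
    using nbhds_neutral_symmetric_cube[OF U] by metis
  \<comment> \<open>\<open>W\<close> lies in \<open>V\<close> together with its conjugates by
    \<open>E\<close>: a shift of the second point reappears, negated and conjugated by
    \<open>g\<close>, at the right end of the difference.\<close>
  define W where "W = {w \<in> V. \<forall>g\<in>E. g + w - g \<in> V}"
  have "eventually (\<lambda>w. \<forall>g\<in>E. g + w - g \<in> V) (nhds 0)"
    using nhds_neutral_conjugate[OF V(1)] E
    by (intro eventually_ball_finite) (auto simp: nbhds_neutral_def)
  then have W: "W \<in> nbhds_neutral"
    using V(1) by (simp add: W_def nbhds_neutral_def eventually_conj_iff)
  have near: "w + x - (g + (w' + x')) \<in> U"
    if "w \<in> W" "w' \<in> W" "g \<in> E" "x - (g + x') \<in> V" for w w' g x x'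
  proof -
    have "w + (x - (g + x')) + - (g + w' - g) \<in> U"
    proof (rule V(3))
      show "w \<in> V" using that(1) by (simp add: W_def)
      show "- (g + w' - g) \<in> V" by (rule V(2)) (use that(2,3) in \<open>simp add: W_def\<close>)
    qed (rule that(4))
    moreover have "w + (x - (g + x')) + - (g + w' - g) = w + x - (g + (w' + x'))"
      by (simp only: diff_conv_add_uminus minus_add minus_minus add.assoc)
         (simp only: add.assoc[symmetric] add_minus_cancel minus_add_cancel add_0_left add_0_right left_minus right_minus)
    ultimately show ?thesis by simp
  qed
  \<comment> \<open>The total error will be \<open>2 * (N * \<delta>)\<close>;
    \<open>\<delta> \<le> 1 / 2\<close> yields \<open>N \<le> 2 * card F\<close>, and then
    \<open>4 * \<delta> \<le> \<epsilon>\<close> suffices.\<close>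
  define \<delta> where "\<delta> = min (\<epsilon> / 4) (1 / 2)"
  have \<delta>: "0 < \<delta>" "\<delta> \<le> 1 / 2" "4 * \<delta> \<le> \<epsilon>" using \<epsilon> by (auto simp: \<delta>_def)
  obtain X p where X: "finite X" and p: "\<And>x. x \<in> X \<Longrightarrow> 0 \<le> p x" "sum p X = 1"
    and main: "\<And>S g. S \<subseteq> X \<Longrightarrow> g \<in> E \<Longrightarrow> sum p S \<le> sum p {y\<in>X. \<exists>s\<in>S. y - (g + s) \<in> V} + \<delta>"
    by (rule amenable_finite_weights[OF am V(1) E \<delta>(1)]) blast
  \<comment> \<open>Rounding loses at most one unit per point of \<open>X\<close>, in total at most
    \<open>N * \<delta>\<close>; the summand \<open>1\<close> keeps \<open>N\<close>
    positive.\<close>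
  obtain N :: nat where "real (card X) / \<delta> + 1 \<le> real N"
    using real_arch_simple by blast
  then have N: "real (card X) \<le> real N * \<delta>" "0 < N"
    using \<delta>(1) by (auto simp: field_simps intro: gr0I)
  define k where "k x = nat \<lfloor>real N * p x\<rfloor>" for x
  have k: "real (k x) \<le> real N * p x" "real N * p x \<le> real (k x) + 1" if "x \<in> X" for x
    using p(1)[OF that] by (simp_all add: k_def of_nat_nat)
  define I where "I = Sigma X (\<lambda>x. {..<k x})"
  have finI: "finite I" using X by (simp add: I_def)
  \<comment> \<open>Points conflict if they are equal or translates of each other by an element of
    \<open>E\<close>. Avoiding conflicts makes \<open>c\<close> injective and keeps \<open>F\<close>
    off \<open>g + F\<close> for \<open>g \<noteq> 0\<close>.\<close>
  define R where "R y = {z. z = y \<or> (\<exists>g\<in>E. z = g + y \<or> y = g + z)}" for y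
  have fin_R: "finite (R y)" for y
  proof (rule finite_subset)
    have "z = - g + y" if "y = g + z" for z g using that by (simp add: add.assoc[symmetric])
    then show "R y \<subseteq> {y} \<union> (\<Union>g\<in>E. {g + y, - g + y})" by (auto simp: R_def)
  qed (use E in simp)
  have sym_R: "x \<in> R y" if "y \<in> R x" for x y
    using that by (auto simp: R_def)
  have inf_W: "infinite ((\<lambda>w. w + fst a) ` W)" for a :: "'a \<times> nat"
    using infinite_nbhds_neutral[OF nd W] by (simp add: finite_image_iff)
  have "\<exists>c. (\<forall>a\<in>I. c a \<in> (\<lambda>w. w + fst a) ` W) \<and> (\<forall>a\<in>I. \<forall>b\<in>I. a \<noteq> b \<longrightarrow> c a \<notin> R (c b))"
    by (rule generic_choice[OF finI inf_W fin_R]) (rule sym_R)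
  then obtain c where c_all: "\<forall>a\<in>I. c a \<in> (\<lambda>w. w + fst a) ` W"
      "\<forall>a\<in>I. \<forall>b\<in>I. a \<noteq> b \<longrightarrow> c a \<notin> R (c b)"
    by (elim exE conjE)
  have c: "c a \<in> (\<lambda>w. w + fst a) ` W" "b \<in> I \<Longrightarrow> a \<noteq> b \<Longrightarrow> c a \<notin> R (c b)" if "a \<in> I" for a b
    using c_all that by simp_all
  have inj: "inj_on c I" using c(2) by (force simp: inj_on_def R_def)
  define F where "F = c ` I"
  have card_Sigma: "card (Sigma Y (\<lambda>x. {..<k x})) = sum k Y" if "Y \<subseteq> X" for Y
    using X that finite_subset by (subst card_SigmaI) auto
  have card_F: "card F = sum k X"
    using inj card_Sigma[of X] by (simp add: F_def card_image I_def)
  have sum_k: "real N * sum p Y \<le> real (sum k Y) + real (card X)" if "Y \<subseteq> X" for Y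
  proof -
    have "real N * sum p Y \<le> (\<Sum>x\<in>Y. real (k x) + 1)"
      unfolding sum_distrib_left using k(2) that by (intro sum_mono) auto
    also have "\<dots> = real (sum k Y) + real (card Y)" by (simp add: sum.distrib)
    also have "card Y \<le> card X" using X that by (rule card_mono)
    finally show ?thesis by simp
  qed
  have "real N \<le> real (card F) + real N * \<delta>"
    using sum_k[of X] p(2) N(1) card_F by simp
  moreover have "real N * \<delta> \<le> real N * (1 / 2)" using \<delta>(2) by (intro mult_left_mono) auto
  ultimately have NF: "real N \<le> 2 * real (card F)" by simp
  show thesis
  proof (rule that[of F])
    show "finite F" using finI by (simp add: F_def)
    show "F \<noteq> {}" using NF N(2) by auto
    show "t \<noteq> g + s" if "g \<in> E" "g \<noteq> 0" "s \<in> F" "t \<in> F" for g s t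
    proof
      assume eq: "t = g + s"
      from that obtain a b where ab: "a \<in> I" "b \<in> I" "s = c a" "t = c b" by (auto simp: F_def)
      have "b \<noteq> a"
      proof
        assume "b = a"
        with eq ab have "g + s = 0 + s" by simp
        with that(2) show False by (simp only: add_right_cancel)
      qed
      with c(2)[of b a] ab eq that(1) show False by (auto simp: R_def)
    qed
    fix S g assume S: "S \<subseteq> F" and g: "g \<in> E"
    \<comment> \<open>\<open>S'\<close> collects the base points in \<open>X\<close> of the points
      of \<open>S\<close>. The estimate passes from \<open>S\<close> to \<open>S'\<close>, by the
      weight inequality to \<open>T\<close>, and from there back to points of
      \<open>F\<close>.\<close>
    define S' where "S' = fst ` {a \<in> I. c a \<in> S}"
    define T where "T = {y\<in>X. \<exists>s\<in>S'. y - (g + s) \<in> V}"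
    have S': "S' \<subseteq> X" by (auto simp: S'_def I_def)
    have T: "T \<subseteq> X" by (auto simp: T_def)
    have "S \<subseteq> c ` Sigma S' (\<lambda>x. {..<k x})"
    proof
      fix s assume "s \<in> S"
      then obtain a where a: "a \<in> I" "s = c a" using S by (auto simp: F_def)
      then have "a \<in> Sigma S' (\<lambda>x. {..<k x})"
        using \<open>s \<in> S\<close> by (cases a) (force simp: S'_def I_def)
      with a show "s \<in> c ` Sigma S' (\<lambda>x. {..<k x})" by blast
    qed
    then have "card S \<le> sum k S'"
      using surj_card_le[of "Sigma S' (\<lambda>x. {..<k x})" S c] card_Sigma[OF S'] finite_subset[OF S' X] by auto
    moreover have "real (sum k S') \<le> real N * sum p S'"
      unfolding of_nat_sum sum_distrib_left using k(1) S' by (intro sum_mono) auto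
    moreover have "real N * sum p S' \<le> real N * (sum p T + \<delta>)"
      using main[OF S' g] by (intro mult_left_mono) (auto simp: T_def)
    moreover have "real N * (sum p T + \<delta>) = real N * sum p T + real N * \<delta>"
      by (simp add: distrib_left)
    moreover have "real N * sum p T \<le> real (sum k T) + real (card X)" by (rule sum_k[OF T])
    moreover have "sum k T \<le> card {y\<in>F. \<exists>s\<in>S. y - (g + s) \<in> U}"
    proof -
      let ?J = "Sigma T (\<lambda>x. {..<k x})"
      have J: "?J \<subseteq> I" using T by (auto simp: I_def)
      have "c a \<in> {y\<in>F. \<exists>s\<in>S. y - (g + s) \<in> U}" if a: "a \<in> ?J" for a
      proof -
        from a obtain b where b: "b \<in> I" "c b \<in> S" "fst a - (g + fst b) \<in> V"
          by (force simp: T_def S'_def)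
        obtain w w' where "w \<in> W" "c a = w + fst a" "w' \<in> W" "c b = w' + fst b"
          using c(1)[of a] c(1)[of b] a J b(1) by blast
        then have "c a - (g + c b) \<in> U" using near g b(3) by simp
        then show ?thesis using a J b(2) by (auto simp: F_def)
      qed
      then have "card (c ` ?J) \<le> card {y\<in>F. \<exists>s\<in>S. y - (g + s) \<in> U}"
        using finI by (intro card_mono) (auto simp: F_def)
      moreover have "card (c ` ?J) = sum k T"
        using inj_on_subset[OF inj J] card_Sigma[OF T] by (simp add: card_image)
      ultimately show ?thesis by simp
    qed
    ultimately have "real (card S) \<le>
        real (card {y\<in>F. \<exists>s\<in>S. y - (g + s) \<in> U}) + 2 * (real N * \<delta>)"
      using N(1) by linarith
    also have "2 * (real N * \<delta>) \<le> 4 * \<delta> * real (card F)"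
      using mult_right_mono[OF NF, of \<delta>] \<delta>(1) by (simp add: mult_ac)
    also have "\<dots> \<le> \<epsilon> * real (card F)" using \<delta>(3) by (intro mult_right_mono) auto
    finally show "real (card S) \<le>
        real (card {y\<in>F. \<exists>s\<in>S. y - (g + s) \<in> U}) + \<epsilon> * real (card F)" by simp
  qed
qed

section \<open>Gluing permutations\<close>

text \<open>Exchanging each \<open>s\<close> with \<open>\<psi> s\<close> is an involution;
  disjointness prevents conflicting prescriptions.\<close>

lemma bij_swap_extension:
  fixes \<psi> :: "'a \<Rightarrow> 'a"
  assumes inj: "inj_on \<psi> A" and disj: "A \<inter> \<psi> ` A = {}"
  obtains \<beta> where "bij \<beta>" "\<And>s. s \<in> A \<Longrightarrow> \<beta> s = \<psi> s" "\<And>s. s \<in> A \<Longrightarrow> \<beta> (\<psi> s) = s"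
    "\<And>x. x \<notin> A \<Longrightarrow> x \<notin> \<psi> ` A \<Longrightarrow> \<beta> x = x"
proof -
  define \<beta> where "\<beta> x = (if x \<in> A then \<psi> x else if x \<in> \<psi> ` A then inv_into A \<psi> x else x)" for x
  have 1: "\<beta> s = \<psi> s" if "s \<in> A" for s using that by (simp add: \<beta>_def)
  have 2: "\<beta> (\<psi> s) = s" if "s \<in> A" for s
    using that inj disj by (auto simp: \<beta>_def)
  have 3: "\<beta> x = x" if "x \<notin> A" "x \<notin> \<psi> ` A" for x using that by (simp add: \<beta>_def)
  have "\<beta> (\<beta> x) = x" for x
    using 1 2 3 by (cases "x \<in> A"; cases "x \<in> \<psi> ` A") auto
  then have "bij \<beta>" by (rule involuntory_imp_bij)
  with 1 2 3 show thesis using that by blast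
qed

text \<open>Following \<open>\<beta> g\<close> by translation by \<open>g\<close> sends each matched
  point of \<open>F\<close> to its partner in \<open>F\<close>, so only unmatched points can leave
  \<open>F\<close>. The set \<open>K\<close> is one finite support for all \<open>\<beta> g\<close>,
  which later allows translates of them to be glued.\<close>

lemma amenable_almost_invariant_permutations:
  fixes U :: "'a::{topological_group_add, t2_space} set"
  assumes am: "amenable_topological_group TYPE('a)" and nd: "{0} \<notin> (nbhds_neutral :: 'a set set)"
    and U: "U \<in> nbhds_neutral" and E: "finite E" and \<epsilon>: "0 < (\<epsilon>::real)"
  shows "\<exists>F K \<beta>. finite F \<and> F \<noteq> {} \<and> finite K \<and> F \<subseteq> K \<and> (\<forall>g\<in>E. bij (\<beta> g) \<and>
    (\<forall>x. g + \<beta> g x - (g + x) \<in> U) \<and> (\<forall>x. x \<notin> K \<longrightarrow> \<beta> g x = x) \<and>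
    real (card {x\<in>F. g + \<beta> g x \<notin> F}) \<le> \<epsilon> * real (card F))"
proof -
  obtain V where V: "V \<in> nbhds_neutral" "\<And>x. x \<in> V \<Longrightarrow> - x \<in> V"
      "\<And>x y z. x \<in> V \<Longrightarrow> y \<in> V \<Longrightarrow> z \<in> V \<Longrightarrow> x + y + z \<in> U"
    by (rule nbhds_neutral_symmetric_cube[OF U]) blast
  have VU: "x \<in> U" if "x \<in> V" for x
    using V(3)[OF that zero_in_nbhds_neutral[OF V(1)] zero_in_nbhds_neutral[OF V(1)]] by simp
  obtain F where F: "finite F" "F \<noteq> {}"
    and free: "\<And>g s t. g \<in> E \<Longrightarrow> g \<noteq> 0 \<Longrightarrow> s \<in> F \<Longrightarrow> t \<in> F \<Longrightarrow> t \<noteq> g + s"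
    and hall: "\<And>S g. S \<subseteq> F \<Longrightarrow> g \<in> E \<Longrightarrow>
      real (card S) \<le> real (card {y\<in>F. \<exists>s\<in>S. y - (g + s) \<in> V}) + \<epsilon> * real (card F)"
    by (rule amenable_finite_sets[OF am nd V(1) E \<epsilon>]) blast
  define K where "K = F \<union> (\<Union>g\<in>E. (\<lambda>y. - g + y) ` F)"
  define good where "good g b \<longleftrightarrow> bij b \<and> (\<forall>x. g + b x - (g + x) \<in> U) \<and>
    (\<forall>x. x \<notin> K \<longrightarrow> b x = x) \<and> real (card {x\<in>F. g + b x \<notin> F}) \<le> \<epsilon> * real (card F)" for g b
  have "\<exists>b. good g b" if g: "g \<in> E" for g
  proof (cases "g = 0")
    case True
    then have empty: "{x\<in>F. g + id x \<notin> F} = {}" by auto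
    have "real (card {x\<in>F. g + id x \<notin> F}) \<le> \<epsilon> * real (card F)"
      unfolding empty using \<epsilon> by simp
    moreover have "g + id x - (g + x) \<in> U" for x
      using zero_in_nbhds_neutral[OF U] by simp
    ultimately have "good g id" unfolding good_def by (intro conjI allI impI bij_id) simp_all
    then show ?thesis by blast
  next
    case False
    define N where "N s = {y\<in>F. y - (g + s) \<in> V}" for s
    have hallN: "card S \<le> card (\<Union>(N ` S)) + nat \<lfloor>\<epsilon> * real (card F)\<rfloor>" if "S \<subseteq> F" for S
    proof -
      have "\<Union>(N ` S) = {y\<in>F. \<exists>s\<in>S. y - (g + s) \<in> V}" by (auto simp: N_def)
      then have "real (card S) - real (card (\<Union>(N ` S))) \<le> \<epsilon> * real (card F)"
        using hall[OF that g] by simp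
      then have "int (card S) - int (card (\<Union>(N ` S))) \<le> \<lfloor>\<epsilon> * real (card F)\<rfloor>"
        by (simp add: le_floor_iff)
      then show ?thesis by linarith
    qed
    have finN: "finite (N s)" for s using F(1) by (simp add: N_def)
    obtain A \<phi> where A: "A \<subseteq> F" "card (F - A) \<le> nat \<lfloor>\<epsilon> * real (card F)\<rfloor>"
      and \<phi>: "inj_on \<phi> A" "\<forall>s\<in>A. \<phi> s \<in> N s"
      by (rule hall_marriage_deficiency[OF F(1) finN hallN], assumption, rule that)
    \<comment> \<open>\<open>\<psi>\<close> is the matching translated back by \<open>g\<close>, so
      a value of \<open>\<psi>\<close> inside \<open>A\<close> would give a point common to
      \<open>F\<close> and \<open>g + F\<close>.\<close>
    define \<psi> where "\<psi> s = - g + \<phi> s" for s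
    have g\<psi>: "g + \<psi> s = \<phi> s" for s by (simp add: \<psi>_def add.assoc[symmetric])
    have \<phi>F: "\<phi> s \<in> F" "\<phi> s - (g + s) \<in> V" if "s \<in> A" for s
      using \<phi>(2) that by (auto simp: N_def)
    have "inj_on \<psi> A" using \<phi>(1) by (auto simp: inj_on_def \<psi>_def)
    moreover have "A \<inter> \<psi> ` A = {}"
    proof -
      have "\<psi> s \<noteq> t" if "s \<in> A" "t \<in> A" for s t
        using free[OF g False, of t "\<phi> s"] \<phi>F(1)[OF that(1)] A(1) that g\<psi>[of s] by auto
      then show ?thesis by auto
    qed
    ultimately obtain b where b: "bij b" "\<And>s. s \<in> A \<Longrightarrow> b s = \<psi> s" "\<And>s. s \<in> A \<Longrightarrow> b (\<psi> s) = s"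
        "\<And>x. x \<notin> A \<Longrightarrow> x \<notin> \<psi> ` A \<Longrightarrow> b x = x"
      by (rule bij_swap_extension) blast
    have "g + b x - (g + x) \<in> V" for x
    proof -
      consider "x \<in> A" | s where "s \<in> A" "x = \<psi> s" | "x \<notin> A" "x \<notin> \<psi> ` A" by blast
      then show ?thesis
      proof cases
        case 1
        then show ?thesis using \<phi>F(2) b(2) g\<psi> by simp
      next
        case 2
        \<comment> \<open>At a swapped point the difference is the negative of the one at its
          partner, and \<open>V\<close> is symmetric.\<close>
        have "g + b x - (g + x) = - (\<phi> s - (g + s))"
          unfolding 2(2) b(3)[OF 2(1)] g\<psi> by (rule minus_diff_eq[symmetric])
        then show ?thesis using V(2)[OF \<phi>F(2)[OF 2(1)]] by (simp only:)
      next
        case 3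
        then show ?thesis using b(4) zero_in_nbhds_neutral[OF V(1)] by simp
      qed
    qed
    moreover have "b x = x" if "x \<notin> K" for x
    proof -
      have "A \<subseteq> K" using A(1) by (auto simp: K_def)
      moreover have "\<psi> ` A \<subseteq> K" using \<phi>F(1) g by (auto simp: K_def \<psi>_def)
      ultimately show ?thesis using b(4) that by blast
    qed
    moreover have "real (card {x\<in>F. g + b x \<notin> F}) \<le> \<epsilon> * real (card F)"
    proof -
      have "{x\<in>F. g + b x \<notin> F} \<subseteq> F - A" using b(2) \<phi>F(1) g\<psi> by auto
      then have "card {x\<in>F. g + b x \<notin> F} \<le> card (F - A)" using F(1) by (intro card_mono) auto
      then have "real (card {x\<in>F. g + b x \<notin> F}) \<le> real (nat \<lfloor>\<epsilon> * real (card F)\<rfloor>)"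
        using A(2) by linarith
      also have "\<dots> \<le> \<epsilon> * real (card F)" using \<epsilon> by (simp add: of_nat_nat)
      finally show ?thesis .
    qed
    ultimately have "good g b" unfolding good_def using b(1) VU by (intro conjI allI impI) simp_all
    then show ?thesis by blast
  qed
  then obtain \<beta> where \<beta>: "\<And>g. g \<in> E \<Longrightarrow> good g (\<beta> g)" by metis
  have "finite K" "F \<subseteq> K" using F(1) E by (auto simp: K_def)
  with F \<beta> show ?thesis
    unfolding good_def by (intro exI[of _ F] exI[of _ K] exI[of _ \<beta>] conjI ballI) simp_all
qed

text \<open>Transfinite recursion along a well-order of the group of minimal type. An infinite group
  has as many finite subsets as elements, so these can be indexed by the group itself; at each stage
  fewer sets than elements of the group have been placed, each forbidding only finitely many
  translations.\<close>

lemma disjoint_right_translates: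
  fixes K :: "'a::group_add set \<Rightarrow> 'a set"
  assumes inf: "infinite (UNIV :: 'a set)" and K: "\<And>E. finite E \<Longrightarrow> finite (K E)"
  shows "\<exists>t. \<forall>E E'. finite E \<longrightarrow> finite E' \<longrightarrow> E \<noteq> E' \<longrightarrow>
    (\<lambda>y. y + t E) ` K E \<inter> (\<lambda>y. y + t E') ` K E' = {}"
proof -
  obtain e :: "'a \<Rightarrow> 'a set" where e: "bij_betw e (UNIV :: 'a set) (Fpow UNIV)"
    using card_of_Fpow_infinite[OF inf] card_of_ordIso[of "UNIV :: 'a set" "Fpow UNIV"]
      ordIso_symmetric by blast
  have fin: "finite (K (e i))" for i
    using e by (intro K) (auto simp: bij_betw_def Fpow_def)
  define r where "r = card_of (UNIV :: 'a set)"
  have r: "Card_order r" "Well_order r" "Field r = UNIV"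
    by (simp_all add: r_def card_of_Card_order card_of_Well_order)
  define P where "P f i t \<longleftrightarrow> (\<forall>j. (j, i) \<in> r - Id \<longrightarrow>
    (\<lambda>y. y + f j) ` K (e j) \<inter> (\<lambda>y. y + t) ` K (e i) = {})" for f i t
  have "\<exists>f. \<forall>i. P f i (f i)"
  proof (rule dependent_wf_choice)
    show "wf (r - Id)" using r(2) by (simp add: well_order_on_def)
    show "P f i t = P f' i t" if "\<And>j. (j, i) \<in> r - Id \<Longrightarrow> f j = f' j" for f f' i t
      using that unfolding P_def by metis
    fix i f
    define J where "J = underS r i"
    \<comment> \<open>The forbidden translations form a set of cardinality less than that of the group.\<close>
  define bad where "bad = (\<Union>j\<in>J. \<Union>k\<in>K (e i). (\<lambda>y. - k + (y + f j)) ` K (e j))"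
    have fin_bad: "finite (\<Union>k\<in>K (e i). (\<lambda>y. - k + (y + f j)) ` K (e j))" for j
      using fin by simp
    have "bad \<noteq> UNIV"
    proof (cases "finite J")
      case True
      then have "finite bad" unfolding bad_def using fin_bad by blast
      with inf show ?thesis by auto
    next
      \<comment> \<open>A union of finite sets over an infinite \<open>J\<close> has cardinality at
        most that of \<open>J\<close>, and proper initial segments of the cardinal \<open>r\<close>
        are smaller than the group.\<close>
      case False
      have "|bad| \<le>o |J|"
        unfolding bad_def
      proof (rule card_of_UNION_ordLeq_infinite[OF False])
        show "\<forall>j\<in>J. |\<Union>k\<in>K (e i). (\<lambda>y. - k + (y + f j)) ` K (e j)| \<le>o |J|"
          using fin_bad False by (meson finite_iff_ordLess_natLeq infinite_iff_natLeq_ordLeq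
              ordLess_imp_ordLeq ordLeq_transitive)
      qed simp
      moreover have "|J| <o r" unfolding J_def by (rule card_of_underS) (use r in auto)
      ultimately have "|bad| <o |UNIV :: 'a set|"
        unfolding r_def using ordLeq_ordLess_trans by blast
      then show ?thesis using not_ordLess_ordIso[of "|bad|"] by (metis card_of_refl)
    qed
    then obtain t where t: "t \<notin> bad" by blast
    have "P f i t"
      unfolding P_def
    proof (intro allI impI equals0I)
      fix j z assume "(j, i) \<in> r - Id" and z: "z \<in> (\<lambda>y. y + f j) ` K (e j) \<inter> (\<lambda>y. y + t) ` K (e i)"
      then have "j \<in> J" by (auto simp: J_def underS_def)
      from z obtain y k where yk: "y \<in> K (e j)" "k \<in> K (e i)" "y + f j = k + t" by auto
      then have "- k + (y + f j) = t" by (simp add: add.assoc[symmetric])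
      with t \<open>j \<in> J\<close> yk(1,2) show False unfolding bad_def by blast
    qed
    then show "\<exists>t. P f i t" by blast
  qed
  then obtain f where f: "\<And>i. P f i (f i)" by blast
  have "(\<lambda>y. y + f i) ` K (e i) \<inter> (\<lambda>y. y + f j) ` K (e j) = {}" if "i \<noteq> j" for i j
  proof -
    have "(i, j) \<in> r - Id \<or> (j, i) \<in> r - Id"
      using r that by (auto simp: order_on_defs total_on_def)
    then show ?thesis using f[of i] f[of j] unfolding P_def by blast
  qed
  moreover have "e (inv_into UNIV e E) = E" if "finite E" for E
    using that e by (intro f_inv_into_f) (auto simp: bij_betw_def Fpow_def)
  ultimately show ?thesis
    by (intro exI[of _ "\<lambda>E. f (inv_into UNIV e E)"]) metis
qed

text \<open>Each \<open>b i\<close> maps \<open>D i\<close> onto itself, so gluing the inverses in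
  the same way gives a two-sided inverse.\<close>

lemma bij_glue:
  fixes b :: "'i \<Rightarrow> 'a \<Rightarrow> 'a"
  assumes bij: "\<And>i. i \<in> I \<Longrightarrow> bij (b i)" and supp: "\<And>i x. i \<in> I \<Longrightarrow> x \<notin> D i \<Longrightarrow> b i x = x"
    and disj: "\<And>i j. i \<in> I \<Longrightarrow> j \<in> I \<Longrightarrow> i \<noteq> j \<Longrightarrow> D i \<inter> D j = {}"
  obtains \<gamma> where "bij \<gamma>" "\<And>i x. i \<in> I \<Longrightarrow> x \<in> D i \<Longrightarrow> \<gamma> x = b i x"
    "\<And>x. (\<And>i. i \<in> I \<Longrightarrow> x \<notin> D i) \<Longrightarrow> \<gamma> x = x"
proof -
  define glue where "glue c x = (if \<exists>i\<in>I. x \<in> D i then c (SOME i. i \<in> I \<and> x \<in> D i) x else x)"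
    for c :: "'i \<Rightarrow> 'a \<Rightarrow> 'a" and x
  have glue_in: "glue c x = c i x" if "i \<in> I" "x \<in> D i" for c i x
  proof -
    have "(SOME i. i \<in> I \<and> x \<in> D i) = i"
      using that disj by (intro some_equality) auto
    then show ?thesis using that by (auto simp: glue_def)
  qed
  have glue_out: "glue c x = x" if "\<And>i. i \<in> I \<Longrightarrow> x \<notin> D i" for c x
    using that by (auto simp: glue_def)
  let ?b' = "\<lambda>i. inv_into UNIV (b i)"
  have inv1: "b i (?b' i x) = x" and inv2: "?b' i (b i x) = x" if "i \<in> I" for i x
    using bij[OF that] by (simp_all add: bij_is_surj surj_f_inv_f bij_is_inj)
  \<comment> \<open>Points outside \<open>D i\<close> are fixed, so by injectivity no point of
    \<open>D i\<close> is mapped there; likewise for the inverse.\<close>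
  have stable: "b i x \<in> D i" "?b' i x \<in> D i" if "i \<in> I" "x \<in> D i" for i x
    using that supp inv1 inv2 by metis+
  have "glue b (glue ?b' x) = x \<and> glue ?b' (glue b x) = x" for x
  proof (cases "\<exists>i\<in>I. x \<in> D i")
    case True
    then obtain i where i: "i \<in> I" "x \<in> D i" by blast
    show ?thesis
      using glue_in[OF i] glue_in[OF i(1) stable(1)[OF i]] glue_in[OF i(1) stable(2)[OF i]]
        inv1[OF i(1)] inv2[OF i(1)] by simp
  qed (use glue_out in simp)
  then have "bij (glue b)" by (intro o_bij[of "glue ?b'"]) (auto simp: fun_eq_iff)
  with glue_in glue_out show thesis using that by blast
qed

text \<open>Cancelling the common part leaves the sums over the image minus \<open>S\<close> and
  over \<open>S\<close> minus the image. Since \<open>a\<close> preserves cardinality, both sets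
  have as many elements as there are points leaving \<open>S\<close>; hence the factor
  \<open>2\<close>.\<close>

lemma abs_sum_image_diff_le:
  fixes f :: "'a \<Rightarrow> real"
  assumes S: "finite S" and inj: "inj_on a S" and B: "\<And>x. \<bar>f x\<bar> \<le> B"
  shows "\<bar>(\<Sum>x\<in>S. f (a x)) - (\<Sum>x\<in>S. f x)\<bar> \<le> 2 * B * real (card {x\<in>S. a x \<notin> S})"
proof -
  have fin: "finite (a ` S)" using S by simp
  have "a ` S - S = a ` {x\<in>S. a x \<notin> S}" by auto
  then have c1: "card (a ` S - S) = card {x\<in>S. a x \<notin> S}"
    using inj by (simp add: card_image inj_on_subset)
  have "card (a ` S) = card S" using inj by (rule card_image)
  then have c2: "card (S - a ` S) = card (a ` S - S)"
    using card_Diff_subset_Int[of S "a ` S"] card_Diff_subset_Int[of "a ` S" S] S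
    by (simp add: Int_commute)
  have bnd: "\<bar>sum f T\<bar> \<le> B * real (card T)" for T
    using order_trans[OF sum_abs sum_bounded_above[of T "\<lambda>x. \<bar>f x\<bar>" B]] B by (simp add: mult.commute)
  have "(\<Sum>x\<in>S. f (a x)) = sum f (a ` S)" using inj by (simp add: sum.reindex)
  also have "\<dots> - sum f S = sum f (a ` S - S) - sum f (S - a ` S)"
    using S fin sum.Int_Diff[of "a ` S" f S] sum.Int_Diff[of S f "a ` S"] by (simp add: Int_commute)
  finally show ?thesis
    using bnd[of "a ` S - S"] bnd[of "S - a ` S"] c1 c2 by simp
qed

section \<open>From the amenable group to an amenable perturbed action\<close>

lemma perturbed_action_amenable_discrete:
  fixes U :: "'a::topological_group_add set"
  assumes am: "amenable_topological_group TYPE('a)" and discrete: "{0} \<in> (nbhds_neutral :: 'a set set)"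
    and U: "U \<in> nbhds_neutral"
  shows "\<exists>\<alpha>\<in>perturbed_translations U. amenable_action (generated_perm_group UNIV UNIV \<alpha>) UNIV (\<lambda>\<gamma>. \<gamma>)"
proof (rule bexI)
  let ?\<alpha> = "\<lambda>g x :: 'a. g + x"
  \<comment> \<open>With the neighbourhood \<open>{0}\<close> available every bounded function is
    right uniformly continuous, so the exact translations already work.\<close>
  have RUC_b: "(RUC_b :: ('a \<Rightarrow> real) set) = ell_infty UNIV"
    using discrete by (auto simp: RUC_b_iff ell_infty_def intro!: bexI[of _ "{0}"])
  show \<alpha>: "?\<alpha> \<in> perturbed_translations U"
    using zero_in_nbhds_neutral[OF U] by (simp add: perturbed_translations_iff bij_plus)
  show "amenable_action (generated_perm_group UNIV UNIV ?\<alpha>) UNIV (\<lambda>\<gamma>. \<gamma>)"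
    by (rule iffD2[OF amenable_action_perturbed_iff[OF \<alpha>]])
      (use am in \<open>simp only: amenable_topological_group_def RUC_b\<close>)
qed

lemma sum_average_is_mean:
  assumes "finite S" "S \<noteq> {}"
  shows "is_mean UNIV (ell_infty UNIV) (\<lambda>f. (\<Sum>x\<in>S. f x) / real (card S))"
  using assms unfolding is_mean_def
  by (auto simp: sum.distrib add_divide_distrib sum_distrib_left[symmetric] sum_nonneg)

text \<open>Right translation by \<open>t E\<close> places the blocks disjointly. For each
  \<open>g\<close> only the blocks with \<open>g \<in> E\<close> take part in the gluing, which is
  enough because \<open>g \<in> E\<close> holds eventually along the finite sets.\<close>

lemma perturbed_action_amenable_nondiscrete:
  fixes U :: "'a::{topological_group_add, t2_space} set"
  assumes am: "amenable_topological_group TYPE('a)" and nd: "{0} \<notin> (nbhds_neutral :: 'a set set)"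
    and U: "U \<in> nbhds_neutral"
  shows "\<exists>\<alpha>\<in>perturbed_translations U. amenable_action (generated_perm_group UNIV UNIV \<alpha>) UNIV (\<lambda>\<gamma>. \<gamma>)"
proof -
  have "UNIV \<in> (nbhds_neutral :: 'a set set)" by (simp add: nbhds_neutral_def)
  then have inf: "infinite (UNIV :: 'a set)" by (rule infinite_nbhds_neutral[OF nd])
  \<comment> \<open>The tolerance tends to \<open>0\<close> along the finite sets because the group
    is infinite; the \<open>+ 1\<close> keeps it positive for empty \<open>E\<close>.\<close>
  define good where "good E F K \<beta> \<longleftrightarrow> finite F \<and> F \<noteq> {} \<and> finite K \<and> F \<subseteq> K \<and> (\<forall>g\<in>E. bij (\<beta> g) \<and>
    (\<forall>x. g + \<beta> g x - (g + x) \<in> U) \<and> (\<forall>x. x \<notin> K \<longrightarrow> \<beta> g x = x) \<and>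
    real (card {x\<in>F. g + \<beta> g x \<notin> F}) \<le> 1 / (real (card E) + 1) * real (card F))"
    for E F K :: "'a set" and \<beta> :: "'a \<Rightarrow> 'a \<Rightarrow> 'a"
  have "\<exists>F K \<beta>. good E F K \<beta>" if "finite E" for E
    unfolding good_def by (rule amenable_almost_invariant_permutations[OF am nd U that]) simp
  then obtain F K \<beta> where good: "\<And>E. finite E \<Longrightarrow> good E (F E) (K E) (\<beta> E)" by metis
  have F: "finite (F E)" "F E \<noteq> {}" "F E \<subseteq> K E" "finite (K E)" if "finite E" for E
    using good[OF that] by (simp_all add: good_def)
  have \<beta>: "bij (\<beta> E g)" "g + \<beta> E g x - (g + x) \<in> U" "x \<notin> K E \<Longrightarrow> \<beta> E g x = x"
      "real (card {x\<in>F E. g + \<beta> E g x \<notin> F E}) \<le> 1 / (real (card E) + 1) * real (card (F E))"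
    if "finite E" "g \<in> E" for E g x
    using good[OF that(1)] that(2) by (simp_all add: good_def)
  obtain t where t: "\<And>E E'. finite E \<Longrightarrow> finite E' \<Longrightarrow> E \<noteq> E' \<Longrightarrow>
      (\<lambda>y. y + t E) ` K E \<inter> (\<lambda>y. y + t E') ` K E' = {}"
    using disjoint_right_translates[OF inf, of K] F(4) by metis
  define D where "D E = (\<lambda>y. y + t E) ` K E" for E
  \<comment> \<open>Right translation leaves the difference unchanged, so moving a block does not
    affect closeness to translation by \<open>g\<close>.\<close>
  have tr: "a + u - (b + u) = a - b" for a b u :: 'a
    by (simp only: diff_conv_add_uminus minus_add add.assoc)
       (simp only: add.assoc[symmetric] right_minus add_0_right)
  have "\<exists>\<gamma>. bij \<gamma> \<and> (\<forall>E x. finite E \<longrightarrow> g \<in> E \<longrightarrow> x \<in> K E \<longrightarrow> \<gamma> (x + t E) = \<beta> E g x + t E) \<and>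
      (\<forall>y. g + \<gamma> y - (g + y) \<in> U)" for g
  proof -
    \<comment> \<open>\<open>b E\<close> is \<open>\<beta> E g\<close> conjugated by right
      translation by \<open>t E\<close>; for \<open>g \<in> E\<close> it is therefore supported in
      \<open>D E\<close>.\<close>
    define b where "b E y = \<beta> E g (y - t E) + t E" for E y
    define I where "I = {E. finite E \<and> g \<in> E}"
    have bij_b: "bij (b E)" if "E \<in> I" for E
    proof -
      have "b E = (\<lambda>x. x + t E) \<circ> \<beta> E g \<circ> (\<lambda>x. x + - t E)" by (simp add: b_def fun_eq_iff)
      then show ?thesis
        using \<beta>(1) that by (simp only:) (intro bij_comp bij_plus_right, simp add: I_def)
    qed
    have b_supp: "b E y = y" if "E \<in> I" "y \<notin> D E" for E y
    proof -
      have "y - t E \<notin> K E"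
      proof
        assume "y - t E \<in> K E"
        then have "y - t E + t E \<in> D E" unfolding D_def by blast
        with that(2) show False by simp
      qed
      then show ?thesis using \<beta>(3) that(1) by (simp add: b_def I_def)
    qed
    have "D E \<inter> D E' = {}" if "E \<in> I" "E' \<in> I" "E \<noteq> E'" for E E'
      unfolding D_def using that by (intro t) (simp_all add: I_def)
    then obtain \<gamma> where \<gamma>: "bij \<gamma>" "\<And>E x. E \<in> I \<Longrightarrow> x \<in> D E \<Longrightarrow> \<gamma> x = b E x"
        "\<And>x. (\<And>E. E \<in> I \<Longrightarrow> x \<notin> D E) \<Longrightarrow> \<gamma> x = x"
      using bij_glue[of I b D, OF bij_b b_supp] by metis
    have \<gamma>_eq: "\<gamma> (x + t E) = \<beta> E g x + t E" if "finite E" "g \<in> E" "x \<in> K E" for E x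
      using \<gamma>(2)[of E "x + t E"] that by (simp add: I_def D_def b_def)
    have "g + \<gamma> y - (g + y) \<in> U" for y
    proof (cases "\<exists>E\<in>I. y \<in> D E")
      case True
      then obtain E x where E: "finite E" "g \<in> E" "x \<in> K E" "y = x + t E"
        by (auto simp: I_def D_def)
      have "g + \<gamma> y - (g + y) = g + \<beta> E g x - (g + x)"
        unfolding E(4) \<gamma>_eq[OF E(1-3)] add.assoc[symmetric] by (rule tr)
      then show ?thesis using \<beta>(2)[OF E(1,2)] by simp
    next
      case False
      then have "\<gamma> y = y" using \<gamma>(3) by blast
      then show ?thesis using zero_in_nbhds_neutral[OF U] by simp
    qed
    with \<gamma>(1) \<gamma>_eq show ?thesis by blast
  qed
  then obtain \<gamma> where bij_\<gamma>: "\<And>g. bij (\<gamma> g)" and near: "\<And>g y. g + \<gamma> g y - (g + y) \<in> U"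
    and \<gamma>: "\<And>g E x. finite E \<Longrightarrow> g \<in> E \<Longrightarrow> x \<in> K E \<Longrightarrow> \<gamma> g (x + t E) = \<beta> E g x + t E"
    by metis
  define \<alpha> where "\<alpha> g y = g + \<gamma> g y" for g y
  have bij_\<alpha>: "bij (\<alpha> g)" for g
  proof -
    have "\<alpha> g = (+) g \<circ> \<gamma> g" by (simp add: \<alpha>_def fun_eq_iff)
    then show ?thesis using bij_\<gamma> by (simp only:) (intro bij_comp bij_plus)
  qed
  have \<alpha>: "\<alpha> \<in> perturbed_translations U"
    using bij_\<alpha> near by (simp add: perturbed_translations_iff \<alpha>_def)
  define S where "S E = (\<lambda>x. x + t E) ` F E" for E
  have S: "finite (S E)" "S E \<noteq> {}" if "finite E" for E
    using F[OF that] by (simp_all add: S_def)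
  have card_bad: "real (card {y\<in>S E. \<alpha> g y \<notin> S E}) \<le> 1 / (real (card E) + 1) * real (card (S E))"
    if E: "finite E" "g \<in> E" for E g
  proof -
    have "inj_on (\<lambda>x. x + t E) A" for A by (simp add: inj_on_def)
    note card_tr = card_image[OF this]
    have "{y\<in>S E. \<alpha> g y \<notin> S E} \<subseteq> (\<lambda>x. x + t E) ` {x\<in>F E. g + \<beta> E g x \<notin> F E}"
    proof
      fix y assume y: "y \<in> {y\<in>S E. \<alpha> g y \<notin> S E}"
      then obtain x where x: "x \<in> F E" "y = x + t E" by (auto simp: S_def)
      then have "\<alpha> g y = g + \<beta> E g x + t E"
        using \<gamma>[OF E, of x] F(3)[OF E(1)] by (auto simp: \<alpha>_def add.assoc)
      then have "g + \<beta> E g x \<notin> F E" using y by (auto simp: S_def)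
      with x show "y \<in> (\<lambda>x. x + t E) ` {x\<in>F E. g + \<beta> E g x \<notin> F E}" by blast
    qed
    then have "card {y\<in>S E. \<alpha> g y \<notin> S E} \<le> card ((\<lambda>x. x + t E) ` {x\<in>F E. g + \<beta> E g x \<notin> F E})"
      using F(1)[OF E(1)] by (intro card_mono) auto
    then have "card {y\<in>S E. \<alpha> g y \<notin> S E} \<le> card {x\<in>F E. g + \<beta> E g x \<notin> F E}"
      by (simp only: card_tr)
    moreover have "card (S E) = card (F E)" unfolding S_def by (rule card_tr)
    ultimately show ?thesis using \<beta>(4)[OF E] by simp
  qed
  \<comment> \<open>Infinite \<open>E\<close> are replaced by \<open>{}\<close> so that every
    \<open>m E\<close> is a mean.\<close>
  define m where "m E f = (let T = S (if finite E then E else {}) in (\<Sum>x\<in>T. f x) / real (card T))"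
    for E and f :: "'a \<Rightarrow> real"
  have m_mean: "is_mean UNIV (ell_infty UNIV) (m E)" for E
    unfolding m_def Let_def by (rule sum_average_is_mean) (use S in simp_all)
  have bdd: "bounded (range f)" if "f \<in> ell_infty UNIV" for f :: "'a \<Rightarrow> real"
    using that by (simp add: ell_infty_def)
  obtain M where M: "is_mean UNIV (ell_infty UNIV) M"
    "\<And>f g. f \<in> ell_infty UNIV \<Longrightarrow> g \<in> ell_infty UNIV \<Longrightarrow>
      ((\<lambda>E. m E f - m E g) \<longlongrightarrow> 0) finite_sets_at_top \<Longrightarrow> M f = M g"
    using is_mean_limit[of UNIV "ell_infty UNIV" m finite_sets_at_top,
        OF m_mean ell_infty_const ell_infty_add ell_infty_scale bdd finite_subsets_at_top_neq_bot]
    by blast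
  have "M (f \<circ> \<alpha> g) = M f" if f: "f \<in> ell_infty UNIV" for f g
  proof (rule M(2)[OF ell_infty_comp[OF f] f], simp, rule tendstoI)
    fix e :: real assume "e > 0"
    obtain B where B: "\<And>x. \<bar>f x\<bar> \<le> B"
      using bdd[OF f] by (auto simp: bounded_iff)
    then have "0 \<le> B" using abs_ge_zero order_trans by blast
    \<comment> \<open>For \<open>g \<in> E\<close> the averages of \<open>f\<close> and of its
      composition with \<open>\<alpha> g\<close> differ by at most
      \<open>2 * B / (card E + 1)\<close>, which is below \<open>e\<close> once \<open>E\<close> has
      at least \<open>n\<close> elements.\<close>
    obtain n where n: "2 * B / e < real n" using reals_Archimedean2 by blast
    obtain E0 :: "'a set" where E0: "finite E0" "card E0 = n"
      using infinite_arbitrarily_large[OF inf, of n] by blast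
    have "dist (m E (f \<circ> \<alpha> g) - m E f) 0 < e" if E: "finite E" "insert g E0 \<subseteq> E" for E
    proof -
      define k where "k = real (card E) + 1"
      define c where "c = real (card (S E))"
      have "n \<le> card E" using E E0 card_mono[of E E0] by auto
      then have "2 * B / e < k" using n by (simp add: k_def)
      then have k: "2 * B / k < e" "0 < k" using \<open>e > 0\<close> by (simp_all add: k_def field_simps)
      have c: "0 < c" using S[OF E(1)] by (simp add: c_def card_gt_0_iff)
      have "\<bar>(\<Sum>x\<in>S E. f (\<alpha> g x)) - (\<Sum>x\<in>S E. f x)\<bar> \<le> 2 * B * real (card {x\<in>S E. \<alpha> g x \<notin> S E})"
        by (rule abs_sum_image_diff_le[OF S(1)[OF E(1)] _ B])
           (rule inj_on_subset[OF bij_is_inj[OF bij_\<alpha>]], simp)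
      also have "\<dots> \<le> 2 * B * (1 / k * c)"
        unfolding k_def c_def using \<open>0 \<le> B\<close> E by (intro mult_left_mono card_bad) auto
      finally have "\<bar>(\<Sum>x\<in>S E. f (\<alpha> g x)) - (\<Sum>x\<in>S E. f x)\<bar> / c \<le> 2 * B / k"
        using c k(2) by (simp add: pos_divide_le_eq)
      moreover have "m E (f \<circ> \<alpha> g) - m E f = ((\<Sum>x\<in>S E. f (\<alpha> g x)) - (\<Sum>x\<in>S E. f x)) / c"
        using E(1) by (simp add: m_def Let_def c_def diff_divide_distrib)
      ultimately show ?thesis using k(1) c by (simp add: dist_real_def abs_divide)
    qed
    then show "eventually (\<lambda>E. dist (m E (f \<circ> \<alpha> g) - m E f) 0 < e) finite_sets_at_top"
      unfolding eventually_finite_subsets_at_top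
      using E0(1) by (intro exI[of _ "insert g E0"]) simp
  qed
  with M(1) have "amenable_action (generated_perm_group UNIV UNIV \<alpha>) UNIV (\<lambda>\<gamma>. \<gamma>)"
    unfolding amenable_action_perturbed_iff[OF \<alpha>] by blast
  with \<alpha> show ?thesis by blast
qed

theorem theorem5p3:
  shows "(amenable_topological_group TYPE('a::{topological_group_add, t2_space}) \<longleftrightarrow>
            (\<forall>U\<in>(nbhds_neutral :: 'a set set). \<exists>\<alpha>\<in>perturbed_translations U.
               amenable_action (generated_perm_group UNIV UNIV \<alpha>) UNIV (\<lambda>\<gamma>. \<gamma>)))
       \<and> (amenable_topological_group TYPE('a) \<longleftrightarrow>
            (\<forall>U\<in>(nbhds_neutral :: 'a set set).
               amenable_action (Gamma_U U) (UNIV \<times> perturbed_translations U) (\<lambda>\<gamma>. \<gamma>)))"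
    (is "(?am \<longleftrightarrow> ?two) \<and> (?am \<longleftrightarrow> ?three)")
proof -
  \<comment> \<open>The two cases are whether \<open>0\<close> is isolated or not.\<close>
  have "?two" if "?am"
    using perturbed_action_amenable_discrete[OF that] perturbed_action_amenable_nondiscrete[OF that]
    by blast
  moreover have "?three" if "?two"
    using that Gamma_U_action_amenable by blast
  moreover have "?am" if "?two"
    using that by (rule amenable_if_perturbed_actions_amenable)
  moreover have "?am" if "?three"
    using that by (rule amenable_if_Gamma_U_actions_amenable)
  ultimately show ?thesis by blast
qed

end
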